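(* Let $\alpha: G\curvearrowright X$ be a continuous action of a countably infinite discrete group $G$ on an infinite compact metrizable space $X$. Then the following are equivalent. (i) For any non-empty open sets $A,B\subset X$, if there is a positive integer $n$ such that $(n+1)A\prec nB$, then $A\prec B$. (ii) The action $\alpha: G\curvearrowright X$ has (generalized) dynamical comparison, i.e., whenever $A,B$ are open sets in $X$ such that $A\subset G\cdot B$ and $\mu(A)<1$ for every $\mu\in\operatorname{Pr}_G(X)$ with $\mu(B)=1$, then $A\prec B$.
   Context: Relation $\prec$: for finite sequences of open sets $O_1,\dots,O_n$ and $V_1,\dots,V_m$ in $X$, write $\bigsqcup_{i=1}^n O_i\times\{i\}\prec\bigsqcup_{l=1}^m V_l\times\{l\}$ if for every choice of closed sets $F_i\subset O_i$ ($i=1,\dots,n$) there are, for each $i$, a finite collection of open sets $U^{(i)}_1,\dots,U^{(i)}_{J_i}$ covering $F_i$, elements $s^{(i)}_1,\dots,s^{(i)}_{J_i}\in G$ and indices $k^{(i)}_1,\dots,k^{(i)}_{J_i}\in\{1,\dots,m\}$ such that the sets $s^{(i)}_jU^{(i)}_j\times\{k^{(i)}_j\}$ ($1\le i\le n$, $1\le j\le J_i$) are pairwise disjoint and all contained in $\bigsqcup_{l=1}^m V_l\times\{l\}$. For open sets $O,V$ and positive integers $n,m$, write $nO\prec mV$ if $\bigsqcup_{i=1}^n O\times\{i\}\prec\bigsqcup_{l=1}^m V\times\{l\}$, and write $O\prec V$ for the case $n=m=1$; thus $O\prec V$ means that for each closed $F\subset O$ there are finitely many open sets $U_1,\dots,U_J$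 covering $F$ and $s_1,\dots,s_J\in G$ such that $s_1U_1,\dots,s_JU_J$ are pairwise disjoint subsets of $V$. Premeasures: $\mathcal{A}_0$ is the algebra of subsets of $X$ generated by the open sets. A premeasure on $\mathcal{A}_0$ is a function $\mu:\mathcal{A}_0\to[0,\infty]$ with $\mu(\emptyset)=0$ and $\mu(\bigsqcup_{n=1}^\infty A_n)=\sum_{n=1}^\infty\mu(A_n)$ for each disjoint sequence $(A_n)$ in $\mathcal{A}_0$ whose union is in $\mathcal{A}_0$. $\operatorname{Pr}_G(X)$ is the set of all $G$-invariant premeasures $\mu$ on $\mathcal{A}_0$ that are regular: for all $B\in\mathcal{A}_0$, $\mu(B)=\sup\{\mu(F):F\subset B,\ F\text{ compact}\}$ and $\mu(B)=\inf\{\mu(O):B\subset O,\ O\text{ open}\}$. $G\cdot B=\bigcup_{g\in G}gB$. *)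

theory Defs
  imports "HOL-Analysis.Analysis" "HOL-Algebra.Group_Action"
begin

text \<open>
  An action is a homomorphism \<open>\<phi>\<close> from \<open>G\<close> to the permutations of the underlying set of
  \<open>X\<close> (locale \<^locale>\<open>group_action\<close>); the group carries the discrete topology.
\<close>

definition continuous_action ::
    "('g, 'b) monoid_scheme \<Rightarrow> 'x topology \<Rightarrow> ('g \<Rightarrow> 'x \<Rightarrow> 'x) \<Rightarrow> bool" where
  "continuous_action G X \<phi> \<longleftrightarrow>
     group_action G (topspace X) \<phi> \<and>
     continuous_map (prod_topology (discrete_topology (carrier G)) X) X (\<lambda>(g, x). \<phi> g x)"

definition saturation ::
    "('g, 'b) monoid_scheme \<Rightarrow> ('g \<Rightarrow> 'x \<Rightarrow> 'x) \<Rightarrow> 'x set \<Rightarrow> 'x set" where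
  "saturation G \<phi> B = (\<Union>g\<in>carrier G. \<phi> g ` B)"

text \<open>
  In the next definition the finite sequences are \<open>A 1, \<dots>, A n\<close> and \<open>V 1, \<dots>, V m\<close>;
  values of \<open>A\<close> and \<open>V\<close> at other indices are irrelevant. Disjointness is that of an
  indexed family, so two nonempty translates with different indices \<open>(i, j)\<close> must not coincide.
\<close>

definition dyn_subeq ::
    "('g, 'b) monoid_scheme \<Rightarrow> 'x topology \<Rightarrow> ('g \<Rightarrow> 'x \<Rightarrow> 'x) \<Rightarrow>
     nat \<Rightarrow> (nat \<Rightarrow> 'x set) \<Rightarrow> nat \<Rightarrow> (nat \<Rightarrow> 'x set) \<Rightarrow> bool" where
  "dyn_subeq G X \<phi> n A m V \<longleftrightarrow>
     (\<forall>F. (\<forall>i\<in>{1..n}. closedin X (F i) \<and> F i \<subseteq> A i) \<longrightarrow>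
       (\<exists>(J :: nat \<Rightarrow> nat) (U :: nat \<Rightarrow> nat \<Rightarrow> 'x set) (s :: nat \<Rightarrow> nat \<Rightarrow> 'g) (k :: nat \<Rightarrow> nat \<Rightarrow> nat).
          (\<forall>i\<in>{1..n}.
             F i \<subseteq> (\<Union>j\<in>{1..J i}. U i j) \<and>
             (\<forall>j\<in>{1..J i}.
                openin X (U i j) \<and> s i j \<in> carrier G \<and> k i j \<in> {1..m} \<and>
                (\<phi> (s i j) ` U i j) \<times> {k i j} \<subseteq> (\<Union>l\<in>{1..m}. V l \<times> {l}))) \<and>
          disjoint_family_on (\<lambda>(i, j). (\<phi> (s i j) ` U i j) \<times> {k i j})
            (SIGMA i:{1..n}. {1..J i})))"

definition dyn_subeq_mult ::
    "('g, 'b) monoid_scheme \<Rightarrow> 'x topology \<Rightarrow> ('g \<Rightarrow> 'x \<Rightarrow> 'x) \<Rightarrow>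
     nat \<Rightarrow> 'x set \<Rightarrow> nat \<Rightarrow> 'x set \<Rightarrow> bool" where
  "dyn_subeq_mult G X \<phi> n A m V \<longleftrightarrow> dyn_subeq G X \<phi> n (\<lambda>_. A) m (\<lambda>_. V)"

definition open_algebra :: "'x topology \<Rightarrow> 'x set set" where
  "open_algebra X = algebra (topspace X) hull {U. openin X U}"

text \<open>
  A premeasure is represented by a total function of which only the values on
  \<^term>\<open>open_algebra X\<close> matter.
\<close>

definition premeasure_on :: "'x set set \<Rightarrow> ('x set \<Rightarrow> ennreal) \<Rightarrow> bool" where
  "premeasure_on \<A> \<mu> \<longleftrightarrow> positive \<A> \<mu> \<and> countably_additive \<A> \<mu>"

definition regular_on :: "'x topology \<Rightarrow> ('x set \<Rightarrow> ennreal) \<Rightarrow> bool" where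
  "regular_on X \<mu> \<longleftrightarrow>
     (\<forall>B\<in>open_algebra X.
        \<mu> B = (SUP F\<in>{F. F \<subseteq> B \<and> compactin X F}. \<mu> F) \<and>
        \<mu> B = (INF W\<in>{W. B \<subseteq> W \<and> openin X W}. \<mu> W))"

definition invariant_premeasures ::
    "('g, 'b) monoid_scheme \<Rightarrow> 'x topology \<Rightarrow> ('g \<Rightarrow> 'x \<Rightarrow> 'x) \<Rightarrow> ('x set \<Rightarrow> ennreal) set" where
  "invariant_premeasures G X \<phi> =
     {\<mu>. premeasure_on (open_algebra X) \<mu> \<and>
          (\<forall>g\<in>carrier G. \<forall>B\<in>open_algebra X. \<mu> (\<phi> g ` B) = \<mu> B) \<and>
          regular_on X \<mu>}"

definition dynamical_comparison ::
    "('g, 'b) monoid_scheme \<Rightarrow> 'x topology \<Rightarrow> ('g \<Rightarrow> 'x \<Rightarrow> 'x) \<Rightarrow> bool" where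
  "dynamical_comparison G X \<phi> \<longleftrightarrow>
     (\<forall>A B. openin X A \<and> openin X B \<and> A \<subseteq> saturation G \<phi> B \<and>
            (\<forall>\<mu>\<in>invariant_premeasures G X \<phi>. \<mu> B = 1 \<longrightarrow> \<mu> A < 1) \<longrightarrow>
            dyn_subeq_mult G X \<phi> 1 A 1 B)"

end

theory Submission
  imports Defs
begin

text \<open>
  Condition (i) yields \<open>A \<prec> B\<close> as soon as \<open>(n + 1) A \<prec> n B\<close> holds for some \<open>n\<close>, so the theorem
  amounts to a description of the pairs for which such an \<open>n\<close> exists. If \<open>(n + 1) A \<prec> n B\<close>,
  counting the pieces with an invariant premeasure \<open>\<mu>\<close> gives \<open>(n + 1) \<mu> A \<le> n \<mu> B\<close>, whence
  (ii) implies (i); this is \<open>dyn_subeq_imp_premeasure_less\<close>. For the other implication, let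
  \<open>F \<subseteq> A\<close> be closed and let \<open>f\<close> be continuous with values in \<open>[0, 1]\<close>, supported in \<open>A\<close> and equal
  to \<open>1\<close> on a neighbourhood \<open>O\<close> of \<open>F\<close>. It is shown that either \<open>(n + 1) O \<prec> n B\<close> for some \<open>n\<close>,
  or some invariant premeasure satisfies \<open>\<mu> B = 1 \<le> \<mu> A\<close>.

  The argument replaces open sets by nonnegative continuous functions. Say that \<open>f\<close> is transported
  below \<open>w\<close> if \<open>f\<close> is a finite sum of continuous functions whose translates by suitable group
  elements sum to at most \<open>w\<close>. For functions it is trivial to cut pieces, which for open sets
  runs into boundaries: transport is additive, and it respects the Riesz decomposition of sums.

  Suppose that \<open>f\<close> is transported below \<open>t\<close> times the indicator of \<open>B\<close> for some \<open>t < 1\<close>. Over each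
  point, stack the values of a large multiple of the pieces above one another, once at the source
  and once at the target. A copy of \<open>O\<close> is a height at the source; the group element to
  use is read off from the piece met at that height, and the copy of \<open>B\<close> to use from the
  corresponding height at the target. All heights depend continuously on the point, so overlapping
  windows of heights give open pieces, and since \<open>t < 1\<close> the target stack is lower than the
  source stack, even after small gaps have been inserted between the pieces. This is
  \<open>transports_imp_dyn_subeq_mult\<close>.

  If there is no such \<open>t\<close>, the infimum of \<open>t - r\<close>, over all \<open>t, r \<ge> 0\<close> for which \<open>g + r f\<close> is
  transported below \<open>t\<close> times the indicator of \<open>B\<close>, is a nonnegative sublinear functional of \<open>g\<close>.
  It does not change when any summand of its argument is translated, and adding \<open>f\<close> raises it by at
  least \<open>1\<close>. By Zorn's lemma there is a minimal functional with these properties, and minimality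
  forces additivity (\<open>additive_minorant\<close>). The result is an invariant additive functional that is at
  least \<open>1\<close> on \<open>f\<close> and at most \<open>1\<close> on functions below the indicator of \<open>B\<close>. Given the value
  \<open>\<infinity>\<close> wherever no multiple of the indicator of \<open>B\<close> suffices, it is additive on all nonnegative
  continuous functions, and the construction of Riesz and Caratheodory turns it into a regular
  invariant premeasure. Countably many translates of \<open>B\<close> cover \<open>A\<close>, so \<open>B\<close> does not have measure
  \<open>0\<close>, and the premeasure can be normalised at \<open>B\<close> (\<open>exists_invariant_premeasure\<close>).
\<close>

section \<open>Nonnegative continuous functions\<close>

definition nonneg_continuous :: "'x topology \<Rightarrow> ('x \<Rightarrow> real) set" where
  "nonneg_continuous X = {f. continuous_map X euclideanreal f \<and> (\<forall>x\<in>topspace X. 0 \<le> f x)}"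

lemma nonneg_continuousI:
  "continuous_map X euclideanreal f \<Longrightarrow> (\<And>x. x \<in> topspace X \<Longrightarrow> 0 \<le> f x) \<Longrightarrow> f \<in> nonneg_continuous X"
  by (simp add: nonneg_continuous_def)

lemma nonneg_continuousD:
  assumes "f \<in> nonneg_continuous X"
  shows "continuous_map X euclideanreal f" and "x \<in> topspace X \<Longrightarrow> 0 \<le> f x"
  using assms by (auto simp: nonneg_continuous_def)

lemma nonneg_continuous_const: "0 \<le> c \<Longrightarrow> (\<lambda>_. c) \<in> nonneg_continuous X"
  by (simp add: nonneg_continuous_def)

lemma nonneg_continuous_add:
  "\<lbrakk>f \<in> nonneg_continuous X; g \<in> nonneg_continuous X\<rbrakk> \<Longrightarrow> (\<lambda>x. f x + g x) \<in> nonneg_continuous X"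
  by (auto simp: nonneg_continuous_def intro: continuous_map_add)

lemma nonneg_continuous_mult:
  "\<lbrakk>f \<in> nonneg_continuous X; g \<in> nonneg_continuous X\<rbrakk> \<Longrightarrow> (\<lambda>x. f x * g x) \<in> nonneg_continuous X"
  by (auto simp: nonneg_continuous_def intro: continuous_map_real_mult)

lemma nonneg_continuous_cmult:
  "\<lbrakk>0 \<le> c; f \<in> nonneg_continuous X\<rbrakk> \<Longrightarrow> (\<lambda>x. c * f x) \<in> nonneg_continuous X"
  by (auto simp: nonneg_continuous_def intro: continuous_map_real_mult)

lemma nonneg_continuous_min:
  "\<lbrakk>f \<in> nonneg_continuous X; g \<in> nonneg_continuous X\<rbrakk> \<Longrightarrow> (\<lambda>x. min (f x) (g x)) \<in> nonneg_continuous X"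
  by (auto simp: nonneg_continuous_def intro: continuous_map_real_min)

lemma nonneg_continuous_sum:
  "(\<And>i. i \<in> I \<Longrightarrow> f i \<in> nonneg_continuous X) \<Longrightarrow> (\<lambda>x. \<Sum>i\<in>I. f i x) \<in> nonneg_continuous X"
  by (cases "finite I")
     (auto simp: nonneg_continuous_def intro!: continuous_map_sum sum_nonneg)

lemma nonneg_continuous_diff:
  "\<lbrakk>f \<in> nonneg_continuous X; g \<in> nonneg_continuous X; \<And>x. x \<in> topspace X \<Longrightarrow> g x \<le> f x\<rbrakk>
   \<Longrightarrow> (\<lambda>x. f x - g x) \<in> nonneg_continuous X"
  by (auto simp: nonneg_continuous_def intro: continuous_map_diff)

lemma nonneg_continuous_comp:
  "\<lbrakk>f \<in> nonneg_continuous X; continuous_map X X p\<rbrakk> \<Longrightarrow> (\<lambda>x. f (p x)) \<in> nonneg_continuous X"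
  unfolding nonneg_continuous_def
  using continuous_map_compose[of X X p euclideanreal f]
  by (auto simp: o_def continuous_map_def Pi_iff)

text \<open>
  The part of \<open>f\<close> that one summand can absorb is \<open>min f (h a)\<close>, and the rest of \<open>f\<close> lies below
  the remaining summands. Taking minima keeps the pieces continuous without any division.
\<close>

lemma riesz_decomposition:
  assumes "finite T" "\<And>s. s \<in> T \<Longrightarrow> h s \<in> nonneg_continuous X" "f \<in> nonneg_continuous X"
    and "\<And>x. x \<in> topspace X \<Longrightarrow> f x \<le> (\<Sum>s\<in>T. h s x)"
  shows "\<exists>k. (\<forall>s\<in>T. k s \<in> nonneg_continuous X \<and> (\<forall>x\<in>topspace X. k s x \<le> h s x)) \<and>
             (\<forall>x\<in>topspace X. f x = (\<Sum>s\<in>T. k s x))"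
  using assms
proof (induction T arbitrary: f)
  case empty
  then show ?case by (force dest: nonneg_continuousD(2))
next
  case (insert a T)
  note 2 = insert.prems
  let ?g = "\<lambda>x. min (f x) (h a x)"
  have g: "?g \<in> nonneg_continuous X" using 2 by (intro nonneg_continuous_min) auto
  have "(\<lambda>x. f x - ?g x) \<in> nonneg_continuous X" using 2 g by (intro nonneg_continuous_diff) auto
  moreover have "f x - ?g x \<le> (\<Sum>s\<in>T. h s x)" if "x \<in> topspace X" for x
  proof (cases "f x \<le> h a x")
    case True
    then show ?thesis using that nonneg_continuousD(2)[OF 2(1)] by (auto intro!: sum_nonneg)
  next
    case False
    then show ?thesis using 2(3)[OF that] insert(1,2) by simp
  qed
  ultimately obtain k where k: "\<forall>s\<in>T. k s \<in> nonneg_continuous X \<and> (\<forall>x\<in>topspace X. k s x \<le> h s x)"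
    "\<forall>x\<in>topspace X. f x - ?g x = (\<Sum>s\<in>T. k s x)"
    using insert.IH[of "\<lambda>x. f x - ?g x"] 2 by auto
  have "(\<Sum>s\<in>insert a T. (k(a := ?g)) s x) = f x" if "x \<in> topspace X" for x
  proof -
    have "(\<Sum>s\<in>T. (k(a := ?g)) s x) = (\<Sum>s\<in>T. k s x)" using insert(2) by (intro sum.cong) auto
    then show ?thesis using insert(1,2) k(2) that by (simp add: algebra_simps)
  qed
  then show ?case using k(1) g by (intro exI[of _ "k(a := ?g)"]) auto
qed

section \<open>Regular premeasures from additive functionals\<close>

text \<open>
  The test functions of the Riesz representation theorem. The set \<open>K\<close> will be compact, and it may be
  larger than the support of \<open>f\<close>.
\<close>

definition subordinate :: "'x topology \<Rightarrow> 'x set \<Rightarrow> ('x \<Rightarrow> real) set" where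
  "subordinate X U = {f \<in> nonneg_continuous X. (\<forall>x\<in>topspace X. f x \<le> 1) \<and>
     (\<exists>K. closedin X K \<and> K \<subseteq> U \<and> (\<forall>x\<in>topspace X - K. f x = 0))}"

lemma subordinate_mono: "U \<subseteq> V \<Longrightarrow> subordinate X U \<subseteq> subordinate X V"
  unfolding subordinate_def by blast

lemma subordinate_zero: "(\<lambda>_. 0) \<in> subordinate X U"
  unfolding subordinate_def nonneg_continuous_def
  using closedin_empty by fastforce

text \<open>
  A partition of unity for two sets. A Urysohn function separates the disjoint closed sets \<open>K - U\<close>
  and \<open>K - V\<close>; truncating it to its middle third makes the two halves of \<open>f\<close> vanish near these
  sets and not only on them.
\<close>

lemma subordinate_split:
  assumes "normal_space X" "openin X U" "openin X V" and f: "f \<in> subordinate X (U \<union> V)"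
  obtains g h where "g \<in> subordinate X U" "h \<in> subordinate X V" "\<And>x. f x = g x + h x"
proof -
  obtain K where K: "closedin X K" "K \<subseteq> U \<union> V" "\<And>x. x \<in> topspace X - K \<Longrightarrow> f x = 0"
    and f1: "\<And>x. x \<in> topspace X \<Longrightarrow> f x \<le> 1" and fc: "f \<in> nonneg_continuous X"
    using f unfolding subordinate_def by auto
  have "closedin X (K - U)" "closedin X (K - V)" "disjnt (K - U) (K - V)"
    using K assms by (auto simp: disjnt_def closedin_diff)
  then obtain q where qc: "continuous_map X euclideanreal q" and q0: "q ` (K - U) \<subseteq> {0::real}" and q1: "q ` (K - V) \<subseteq> {1}"
    using Urysohn_lemma_alt[OF assms(1)] by metis
  define r where "r = (\<lambda>x. min 1 (max 0 (3 * q x - 1)))"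
  have rc: "continuous_map X euclideanreal r" unfolding r_def
    by (intro continuous_map_real_min continuous_map_real_max continuous_map_diff continuous_map_real_mult
        continuous_map_const[THEN iffD2] qc) auto
  have r01: "0 \<le> r x" "r x \<le> 1" for x unfolding r_def by auto
  define g where "g = (\<lambda>x. f x * r x)"
  define h where "h = (\<lambda>x. f x * (1 - r x))"
  have "g \<in> nonneg_continuous X" unfolding g_def
    by (intro nonneg_continuous_mult fc nonneg_continuousI rc r01)
  moreover have "g x \<le> 1" if "x \<in> topspace X" for x
    unfolding g_def using f1[OF that] r01 nonneg_continuousD(2)[OF fc that] by (simp add: mult_le_one)
  moreover have "closedin X (K \<inter> {x \<in> topspace X. 1/3 \<le> q x})"
    using qc K(1) unfolding continuous_map_upper_lower_semicontinuous_le by blast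
  moreover have "K \<inter> {x \<in> topspace X. 1/3 \<le> q x} \<subseteq> U"
    using q0 by force
  moreover have "\<forall>x\<in>topspace X - (K \<inter> {x \<in> topspace X. 1/3 \<le> q x}). g x = 0"
    using K(3) by (auto simp: g_def r_def)
  ultimately have g: "g \<in> subordinate X U" unfolding subordinate_def by blast
  have "h \<in> nonneg_continuous X" unfolding h_def
    by (intro nonneg_continuous_mult fc nonneg_continuousI continuous_map_diff rc) (auto simp: r01)
  moreover have "h x \<le> 1" if "x \<in> topspace X" for x
    unfolding h_def using f1[OF that] r01[of x] nonneg_continuousD(2)[OF fc that] by (simp add: mult_le_one)
  moreover have "closedin X (K \<inter> {x \<in> topspace X. q x \<le> 2/3})"
    using qc K(1) unfolding continuous_map_upper_lower_semicontinuous_le by blast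
  moreover have "K \<inter> {x \<in> topspace X. q x \<le> 2/3} \<subseteq> V"
    using q1 by force
  moreover have "\<forall>x\<in>topspace X - (K \<inter> {x \<in> topspace X. q x \<le> 2/3}). h x = 0"
    using K(3) by (auto simp: h_def r_def)
  ultimately have h: "h \<in> subordinate X V" unfolding subordinate_def by blast
  show ?thesis by (rule that[OF g h]) (simp add: g_def h_def algebra_simps)
qed

lemma subordinate_add_disjoint:
  assumes f: "f \<in> nonneg_continuous X" "\<And>x. x \<in> topspace X \<Longrightarrow> f x \<le> 1"
    and K: "closedin X K" "K \<subseteq> V" "\<And>x. x \<in> topspace X - K \<Longrightarrow> f x = 0"
    and g: "g \<in> subordinate X (V - K)"
  shows "(\<lambda>x. f x + g x) \<in> subordinate X V"
proof -
  obtain K' where K': "closedin X K'" "K' \<subseteq> V - K" "\<And>x. x \<in> topspace X - K' \<Longrightarrow> g x = 0"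
    and g1: "\<And>x. x \<in> topspace X \<Longrightarrow> g x \<le> 1" and gc: "g \<in> nonneg_continuous X"
    using g unfolding subordinate_def by auto
  have "f x + g x \<le> 1" if "x \<in> topspace X" for x
    using f(2) K(3) K'(2) K'(3) g1 that by (cases "x \<in> K") force+
  moreover have "closedin X (K \<union> K')" "K \<union> K' \<subseteq> V" using K K' by auto
  moreover have "\<forall>x\<in>topspace X - (K \<union> K'). f x + g x = 0" using K(3) K'(3) by simp
  ultimately show ?thesis
    unfolding subordinate_def using nonneg_continuous_add[OF f(1) gc] by blast
qed

lemma open_algebra_is_algebra: "algebra (topspace X) (open_algebra X)"
proof -
  let ?S = "{M. algebra (topspace X) M \<and> {U. openin X U} \<subseteq> M}"
  have eq: "open_algebra X = \<Inter>?S" unfolding open_algebra_def hull_def ..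
  have "{U. openin X U} \<subseteq> Pow (topspace X)" using openin_subset by blast
  then have "\<Inter>?S \<subseteq> Pow (topspace X)" by (intro Inter_lower) (simp add: algebra_Pow)
  moreover have "{} \<in> \<Inter>?S" by auto
  moreover have "\<forall>a\<in>\<Inter>?S. topspace X - a \<in> \<Inter>?S" by (auto simp: algebra_iff_Un)
  moreover have "\<forall>a\<in>\<Inter>?S. \<forall>b\<in>\<Inter>?S. a \<union> b \<in> \<Inter>?S" by (auto simp: algebra_iff_Un)
  ultimately show ?thesis unfolding eq algebra_iff_Un by (intro conjI)
qed

lemma openin_open_algebra: "openin X U \<Longrightarrow> U \<in> open_algebra X"
  unfolding open_algebra_def by (rule hull_inc) simp

lemma open_algebra_least:
  "\<lbrakk>algebra (topspace X) M; \<And>U. openin X U \<Longrightarrow> U \<in> M\<rbrakk> \<Longrightarrow> open_algebra X \<subseteq> M"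
  unfolding open_algebra_def by (rule hull_minimal) auto

text \<open>
  Being both an \<open>F\<^sub>\<sigma>\<close> and a \<open>G\<^sub>\<delta>\<close> is preserved by complements and finite unions, so that it
  passes from the open sets to the algebra that they generate.
\<close>

lemma open_algebra_fsigma:
  assumes "metrizable_space X" "B \<in> open_algebra X"
  shows "fsigma_in X B"
proof -
  have "algebra (topspace X) {E. fsigma_in X E \<and> gdelta_in X E}"
    unfolding algebra_iff_Un
    by (auto simp: fsigma_in_subset dest: fsigma_in_subset intro: fsigma_in_Un gdelta_in_Un fsigma_in_diff gdelta_in_diff)
  moreover have "U \<in> {E. fsigma_in X E \<and> gdelta_in X E}" if "openin X U" for U
    using that assms(1) by (simp add: open_imp_gdelta_in open_imp_fsigma_in)
  ultimately have "open_algebra X \<subseteq> {E. fsigma_in X E \<and> gdelta_in X E}"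
    by (rule open_algebra_least)
  then show ?thesis using assms(2) by auto
qed

text \<open>
  The value on open sets of the measure that represents \<open>L\<close>.
\<close>

definition inner_content :: "'x topology \<Rightarrow> (('x \<Rightarrow> real) \<Rightarrow> ennreal) \<Rightarrow> 'x set \<Rightarrow> ennreal" where
  "inner_content X L U = (SUP f\<in>subordinate X U. L f)"

definition outer_content :: "'x topology \<Rightarrow> (('x \<Rightarrow> real) \<Rightarrow> ennreal) \<Rightarrow> 'x set \<Rightarrow> ennreal" where
  "outer_content X L E = (INF U\<in>{U. openin X U \<and> E \<subseteq> U}. inner_content X L U)"

text \<open>
  The value \<open>\<infinity>\<close> is allowed, also on the constant functions: the measures to be built may be infinite
  on \<open>X\<close> although \<open>X\<close> is compact.
\<close>

locale additive_functional =
  fixes X :: "'x topology" and L :: "('x \<Rightarrow> real) \<Rightarrow> ennreal"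
  assumes compact: "compact_space X" and metrizable: "metrizable_space X"
    and L_add: "\<lbrakk>f \<in> nonneg_continuous X; g \<in> nonneg_continuous X\<rbrakk> \<Longrightarrow> L (\<lambda>x. f x + g x) = L f + L g"
    and L_mono: "\<lbrakk>f \<in> nonneg_continuous X; g \<in> nonneg_continuous X; \<And>x. x \<in> topspace X \<Longrightarrow> f x \<le> g x\<rbrakk> \<Longrightarrow> L f \<le> L g"
    and L_zero: "L (\<lambda>_. 0) = 0"
begin

lemma normal: "normal_space X"
  using metrizable metrizable_imp_normal_space by blast

lemma inner_content_mono: "U \<subseteq> V \<Longrightarrow> inner_content X L U \<le> inner_content X L V"
  unfolding inner_content_def by (intro SUP_subset_mono subordinate_mono) auto

lemma outer_content_mono: "E \<subseteq> F \<Longrightarrow> outer_content X L E \<le> outer_content X L F"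
  unfolding outer_content_def by (rule INF_superset_mono) auto

lemma outer_content_open: "openin X U \<Longrightarrow> outer_content X L U = inner_content X L U"
  unfolding outer_content_def by (intro antisym INF_lower INF_greatest inner_content_mono) auto

lemma subordinate_nonneg_continuous: "f \<in> subordinate X U \<Longrightarrow> f \<in> nonneg_continuous X"
  unfolding subordinate_def by simp

lemma inner_content_empty: "inner_content X L {} = 0"
proof -
  have "L f \<le> 0" if "f \<in> subordinate X {}" for f
  proof -
    have "L f \<le> L (\<lambda>_. 0)"
      using that by (intro L_mono subordinate_nonneg_continuous[of _ "{}"] subordinate_zero) (auto simp: subordinate_def)
    then show ?thesis by (simp add: L_zero)
  qed
  then have "inner_content X L {} \<le> 0" unfolding inner_content_def by (rule SUP_least)
  then show ?thesis by simp
qed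

lemma inner_content_Un:
  assumes "openin X U" "openin X V"
  shows "inner_content X L (U \<union> V) \<le> inner_content X L U + inner_content X L V"
  unfolding inner_content_def[of X L "U \<union> V"]
proof (rule SUP_least)
  fix f assume "f \<in> subordinate X (U \<union> V)"
  then obtain g h where gh: "g \<in> subordinate X U" "h \<in> subordinate X V" "\<And>x. f x = g x + h x"
    using subordinate_split[OF normal assms] by metis
  have "f = (\<lambda>x. g x + h x)" using gh(3) by blast
  then have "L f = L g + L h" using gh L_add subordinate_nonneg_continuous by blast
  also have "\<dots> \<le> inner_content X L U + inner_content X L V"
    unfolding inner_content_def by (intro add_mono SUP_upper gh)
  finally show "L f \<le> inner_content X L U + inner_content X L V" .
qed

lemma inner_content_finite_UN:
  assumes "finite I" "\<And>i. i \<in> I \<Longrightarrow> openin X (U i)"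
  shows "inner_content X L (\<Union>i\<in>I. U i) \<le> (\<Sum>i\<in>I. inner_content X L (U i))"
  using assms
proof (induction I)
  case (insert i I)
  have "inner_content X L (U i \<union> (\<Union>j\<in>I. U j)) \<le> inner_content X L (U i) + inner_content X L (\<Union>j\<in>I. U j)"
    using insert by (intro inner_content_Un) auto
  also have "\<dots> \<le> inner_content X L (U i) + (\<Sum>i\<in>I. inner_content X L (U i))"
    using insert by (intro add_left_mono) auto
  finally show ?case using insert by simp
qed (simp add: inner_content_empty)

text \<open>
  The support of a test function is compact, so it is covered by finitely many of the sets.
\<close>

lemma inner_content_UN:
  fixes U :: "nat \<Rightarrow> 'x set"
  assumes U: "\<And>n. openin X (U n)"
  shows "inner_content X L (\<Union>n. U n) \<le> (\<Sum>n. inner_content X L (U n))"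
  unfolding inner_content_def[of X L "\<Union>n. U n"]
proof (rule SUP_least)
  fix f assume f: "f \<in> subordinate X (\<Union>n. U n)"
  then obtain K where K: "closedin X K" "K \<subseteq> (\<Union>n. U n)" "\<forall>x\<in>topspace X - K. f x = 0"
    unfolding subordinate_def by blast
  have "compactin X K" using K(1) compact closedin_compact_space by blast
  then obtain \<F> where F: "finite \<F>" "\<F> \<subseteq> range U" "K \<subseteq> \<Union>\<F>"
    using K(2) U unfolding compactin_def by (metis (no_types, lifting) imageE)
  then obtain I where I: "finite I" "\<F> = U ` I"
    by (meson finite_subset_image)
  have "f \<in> subordinate X (\<Union>i\<in>I. U i)"
    using f K F I unfolding subordinate_def by blast
  then have "L f \<le> inner_content X L (\<Union>i\<in>I. U i)"
    unfolding inner_content_def by (rule SUP_upper)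
  also have "\<dots> \<le> (\<Sum>i\<in>I. inner_content X L (U i))"
    using I U by (intro inner_content_finite_UN) auto
  also have "\<dots> \<le> (\<Sum>n. inner_content X L (U n))"
    using I by (intro sum_le_suminf) auto
  finally show "L f \<le> (\<Sum>n. inner_content X L (U n))" .
qed

text \<open>
  The usual approximation from outside, with error \<open>e / 2 ^ (n + 1)\<close> for the \<open>n\<close>-th set.
\<close>

lemma outer_content_countably_subadditive:
  fixes E :: "nat \<Rightarrow> 'x set"
  shows "outer_content X L (\<Union>n. E n) \<le> (\<Sum>n. outer_content X L (E n))"
proof (rule ennreal_le_epsilon)
  fix e :: real assume fin: "(\<Sum>n. outer_content X L (E n)) < top_class.top" and e: "0 < e"
  have "\<exists>U. openin X U \<and> E n \<subseteq> U \<and> inner_content X L U \<le> outer_content X L (E n) + ennreal (e * (1/2)^Suc n)" for n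
  proof -
    have "outer_content X L (E n) < top_class.top"
      using fin ennreal_suminf_lessD by blast
    then have "outer_content X L (E n) < outer_content X L (E n) + ennreal (e * (1/2)^Suc n)"
      using e ennreal_add_left_cancel_less[of "outer_content X L (E n)" 0 "ennreal (e * (1/2)^Suc n)"]
      by auto
    then show ?thesis
      unfolding outer_content_def by (subst (asm) INF_less_iff) (auto intro: less_imp_le)
  qed
  then obtain U where U: "\<And>n. openin X (U n)" "\<And>n. E n \<subseteq> U n"
    "\<And>n. inner_content X L (U n) \<le> outer_content X L (E n) + ennreal (e * (1/2)^Suc n)"
    by metis
  have "outer_content X L (\<Union>n. E n) \<le> outer_content X L (\<Union>n. U n)"
    using U by (intro outer_content_mono) blast
  also have "\<dots> = inner_content X L (\<Union>n. U n)" using U by (intro outer_content_open) auto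
  also have "\<dots> \<le> (\<Sum>n. inner_content X L (U n))" using U by (intro inner_content_UN)
  also have "\<dots> \<le> (\<Sum>n. outer_content X L (E n) + ennreal (e * (1/2)^Suc n))"
    using U by (intro suminf_le) auto
  also have "\<dots> = (\<Sum>n. outer_content X L (E n)) + (\<Sum>n. ennreal (e * (1/2)^Suc n))"
    by (simp add: suminf_add)
  also have "(\<Sum>n. ennreal (e * (1/2)^Suc n)) = ennreal e"
    using e by (intro suminf_ennreal_eq) (use power_half_series sums_mult in fastforce)+
  finally show "outer_content X L (\<Union>n. E n) \<le> (\<Sum>n. outer_content X L (E n)) + ennreal e" .
qed

lemma outer_content_empty: "outer_content X L {} = 0"
  by (simp add: outer_content_open inner_content_empty)

lemma outer_measure_space_outer_content: "outer_measure_space (Pow (topspace X)) (outer_content X L)"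
  unfolding outer_measure_space_def positive_def increasing_def countably_subadditive_def
  by (auto simp: outer_content_empty intro: outer_content_mono outer_content_countably_subadditive)

lemma outer_content_Un: "outer_content X L (E \<union> F) \<le> outer_content X L E + outer_content X L F"
proof -
  have "outer_content X L (E \<union> F) = outer_content X L (\<Union>n. binaryset E F n)"
    by (simp add: UN_binaryset_eq)
  also have "\<dots> \<le> (\<Sum>n. outer_content X L (binaryset E F n))"
    by (rule outer_content_countably_subadditive)
  also have "\<dots> = outer_content X L E + outer_content X L F"
    by (simp add: suminf_binaryset_eq outer_content_empty)
  finally show ?thesis .
qed

text \<open>
  The nontrivial half of the Caratheodory condition. For open \<open>V \<supseteq> E\<close>, take a test function \<open>f\<close> in
  \<open>U \<inter> V\<close> with support \<open>K\<close>, and a test function \<open>g\<close> in \<open>V - K\<close>, which is open and contains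
  \<open>E - U\<close>. Their sum is a test function in \<open>V\<close>.
\<close>

lemma open_splits_outer_content:
  assumes U: "openin X U"
  shows "outer_content X L (U \<inter> E) + outer_content X L (E - U) \<le> outer_content X L E"
  unfolding outer_content_def[of X L E]
proof (rule INF_greatest, clarify)
  fix V assume V: "openin X V" "E \<subseteq> V"
  have "L f + outer_content X L (E - U) \<le> inner_content X L V" if f: "f \<in> subordinate X (U \<inter> V)" for f
  proof -
    obtain K where K: "closedin X K" "K \<subseteq> U \<inter> V" "\<And>x. x \<in> topspace X - K \<Longrightarrow> f x = 0"
      and f1: "\<And>x. x \<in> topspace X \<Longrightarrow> f x \<le> 1" and fc: "f \<in> nonneg_continuous X"
      using f unfolding subordinate_def by auto
    have "outer_content X L (E - U) \<le> outer_content X L (V - K)"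
      using V K by (intro outer_content_mono) auto
    also have "\<dots> = inner_content X L (V - K)"
      using V K by (intro outer_content_open) (auto intro: openin_diff)
    finally have "L f + outer_content X L (E - U) \<le> L f + inner_content X L (V - K)"
      by (rule add_left_mono)
    also have "\<dots> = (SUP g\<in>subordinate X (V - K). L f + L g)"
      unfolding inner_content_def using subordinate_zero by (subst ennreal_SUP_add_right) auto
    also have "\<dots> \<le> inner_content X L V"
    proof (rule SUP_least)
      fix g assume g: "g \<in> subordinate X (V - K)"
      have "(\<lambda>x. f x + g x) \<in> subordinate X V"
        using K by (intro subordinate_add_disjoint[OF fc f1 K(1) _ K(3) g]) auto
      then have "L (\<lambda>x. f x + g x) \<le> inner_content X L V"
        unfolding inner_content_def by (rule SUP_upper)
      then show "L f + L g \<le> inner_content X L V"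
        using L_add[OF fc subordinate_nonneg_continuous[OF g]] by simp
    qed
    finally show ?thesis .
  qed
  then have "(SUP f\<in>subordinate X (U \<inter> V). L f + outer_content X L (E - U)) \<le> inner_content X L V"
    by (rule SUP_least)
  moreover have "(SUP f\<in>subordinate X (U \<inter> V). L f + outer_content X L (E - U))
      = inner_content X L (U \<inter> V) + outer_content X L (E - U)"
    unfolding inner_content_def using subordinate_zero by (subst ennreal_SUP_add_left) auto
  moreover have "outer_content X L (U \<inter> E) \<le> inner_content X L (U \<inter> V)"
    using openin_Int[OF U V(1)] V(2) outer_content_open[of "U \<inter> V"] outer_content_mono[of "U \<inter> E" "U \<inter> V"] by fastforce
  ultimately show "outer_content X L (U \<inter> E) + outer_content X L (E - U) \<le> inner_content X L V"
    using add_right_mono order_trans by metis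
qed

lemma measure_space_outer_content:
  "measure_space (topspace X) (lambda_system (topspace X) (Pow (topspace X)) (outer_content X L)) (outer_content X L)"
  using sigma_algebra.caratheodory_lemma[OF sigma_algebra_Pow outer_measure_space_outer_content] .

lemma open_algebra_measurable:
  "open_algebra X \<subseteq> lambda_system (topspace X) (Pow (topspace X)) (outer_content X L)" (is "_ \<subseteq> ?M")
proof (rule open_algebra_least)
  show "algebra (topspace X) ?M"
    using measure_space_outer_content unfolding measure_space_def sigma_algebra_def by blast
  interpret P: algebra "topspace X" "Pow (topspace X)" by (rule algebra_Pow)
  fix U assume U: "openin X U"
  have "outer_content X L (E \<inter> U) + outer_content X L (E - U) = outer_content X L E" for E
  proof (rule antisym)
    show "outer_content X L (E \<inter> U) + outer_content X L (E - U) \<le> outer_content X L E"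
      using open_splits_outer_content[OF U, of E] by (simp add: Int_commute)
    show "outer_content X L E \<le> outer_content X L (E \<inter> U) + outer_content X L (E - U)"
      using outer_content_Un[of "E \<inter> U" "E - U"] by (simp add: Int_Diff_Un)
  qed
  then show "U \<in> ?M"
    unfolding P.lambda_system_eq using openin_subset[OF U] by auto
qed

lemma premeasure_outer_content: "premeasure_on (open_algebra X) (outer_content X L)"
  using measure_space_outer_content open_algebra_measurable
  unfolding premeasure_on_def measure_space_def positive_def countably_additive_def by blast

text \<open>
  Outer regularity is built into the definition. Inner regularity holds even for sets of infinite
  measure: a member of the algebra is an increasing union of closed, hence compact, sets, and the
  measure is continuous along this union.
\<close>

lemma regular_outer_content: "regular_on X (outer_content X L)"
  unfolding regular_on_def
proof (intro ballI conjI)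
  fix B assume B: "B \<in> open_algebra X"
  let ?M = "lambda_system (topspace X) (Pow (topspace X)) (outer_content X L)"
  interpret M: sigma_algebra "topspace X" ?M
    using measure_space_outer_content unfolding measure_space_def by blast
  interpret A: algebra "topspace X" "open_algebra X" by (rule open_algebra_is_algebra)
  have "\<exists>C. (\<forall>n. closedin X (C n)) \<and> (\<forall>n. C n \<subseteq> C (Suc n)) \<and> \<Union> (range C) = B"
    using open_algebra_fsigma[OF metrizable B] by (simp add: fsigma_in_ascending) 
  then obtain C :: "nat \<Rightarrow> 'x set" where C: "\<And>n. closedin X (C n)" "\<And>n. C n \<subseteq> C (Suc n)" "(\<Union>n. C n) = B"
    by blast
  have CM: "C n \<in> ?M" for n
  proof -
    have "topspace X - (topspace X - C n) \<in> open_algebra X"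
      using C(1)[of n] by (intro A.compl_sets openin_open_algebra) auto
    moreover have "topspace X - (topspace X - C n) = C n"
      using closedin_subset[OF C(1)[of n]] by blast
    ultimately show ?thesis using open_algebra_measurable by auto
  qed
  have mono: "incseq C" using C(2) by (rule incseq_SucI)
  have "positive ?M (outer_content X L)" "countably_additive ?M (outer_content X L)"
    using measure_space_outer_content unfolding measure_space_def by auto
  then have "\<forall>A. range A \<subseteq> ?M \<longrightarrow> incseq A \<longrightarrow> (\<Union>i. A i) \<in> ?M \<longrightarrow>
      (\<lambda>i. outer_content X L (A i)) \<longlonglongrightarrow> outer_content X L (\<Union>i. A i)"
    using M.countably_additive_iff_continuous_from_below M.countably_additive_additive by blast
  then have "(\<lambda>n. outer_content X L (C n)) \<longlonglongrightarrow> outer_content X L (\<Union>n. C n)"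
    using CM mono C(3) open_algebra_measurable B by auto
  then have "(\<lambda>n. outer_content X L (C n)) \<longlonglongrightarrow> outer_content X L B"
    unfolding C(3) .
  moreover have "(\<lambda>n. outer_content X L (C n)) \<longlonglongrightarrow> (SUP n. outer_content X L (C n))"
    using mono by (intro LIMSEQ_SUP) (auto simp: incseq_def intro: outer_content_mono)
  ultimately have eq: "outer_content X L B = (SUP n. outer_content X L (C n))"
    using LIMSEQ_unique by blast
  show "outer_content X L B = (SUP F\<in>{F. F \<subseteq> B \<and> compactin X F}. outer_content X L F)"
  proof (rule antisym)
    have "C n \<subseteq> B \<and> compactin X (C n)" for n
      using C compact closedin_compact_space by blast
    then show "outer_content X L B \<le> (SUP F\<in>{F. F \<subseteq> B \<and> compactin X F}. outer_content X L F)"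
      unfolding eq by (intro SUP_least SUP_upper) auto
    show "(SUP F\<in>{F. F \<subseteq> B \<and> compactin X F}. outer_content X L F) \<le> outer_content X L B"
      by (intro SUP_least outer_content_mono) auto
  qed
  have "(INF W\<in>{W. B \<subseteq> W \<and> openin X W}. outer_content X L W)
      = (INF W\<in>{W. openin X W \<and> B \<subseteq> W}. inner_content X L W)"
    by (rule INF_cong) (auto simp: outer_content_open)
  then show "outer_content X L B = (INF W\<in>{W. B \<subseteq> W \<and> openin X W}. outer_content X L W)"
    by (simp add: outer_content_def)
qed

end

section \<open>Additive minorants of sublinear functionals\<close>

text \<open>
  The relation \<open>R\<close> collects the inequalities that a functional has to respect inside every sum; it
  will contain the pointwise order and the pairs of translates.
\<close>

locale functional_cone =
  fixes D :: "('x \<Rightarrow> real) set" and R :: "(('x \<Rightarrow> real) \<times> ('x \<Rightarrow> real)) set"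
    and f0 :: "'x \<Rightarrow> real" and p :: "('x \<Rightarrow> real) \<Rightarrow> real"
  assumes D_zero: "(\<lambda>_. 0) \<in> D"
    and D_add: "\<lbrakk>f \<in> D; g \<in> D\<rbrakk> \<Longrightarrow> (\<lambda>x. f x + g x) \<in> D"
    and D_scale: "\<lbrakk>0 \<le> c; f \<in> D\<rbrakk> \<Longrightarrow> (\<lambda>x. c * f x) \<in> D"
    and R_D: "(g, h) \<in> R \<Longrightarrow> g \<in> D \<and> h \<in> D"
    and R_zero: "g \<in> D \<Longrightarrow> ((\<lambda>_. 0), g) \<in> R"
    and f0: "f0 \<in> D"
begin

text \<open>
  The last clause is a form of the lower bound \<open>1 \<le> m f0\<close> that survives the modification \<open>absorb\<close>
  below. The first clause makes the pointwise order antisymmetric on functionals on \<open>D\<close>.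
\<close>

definition admissible :: "(('x \<Rightarrow> real) \<Rightarrow> real) \<Rightarrow> bool" where
  "admissible m \<longleftrightarrow>
     (\<forall>f. f \<notin> D \<longrightarrow> m f = 0) \<and>
     (\<forall>f\<in>D. m f \<le> p f) \<and>
     (\<forall>f\<in>D. \<forall>g\<in>D. m (\<lambda>x. f x + g x) \<le> m f + m g) \<and>
     (\<forall>c\<ge>0. \<forall>f\<in>D. m (\<lambda>x. c * f x) = c * m f) \<and>
     (\<forall>f\<in>D. \<forall>(g, h)\<in>R. m (\<lambda>x. f x + g x) \<le> m (\<lambda>x. f x + h x)) \<and>
     (\<forall>f\<in>D. m f + 1 \<le> m (\<lambda>x. f x + f0 x))"

lemma admissibleD:
  assumes "admissible m"
  shows "f \<notin> D \<Longrightarrow> m f = 0"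
    and "f \<in> D \<Longrightarrow> m f \<le> p f"
    and "\<lbrakk>f \<in> D; g \<in> D\<rbrakk> \<Longrightarrow> m (\<lambda>x. f x + g x) \<le> m f + m g"
    and "\<lbrakk>0 \<le> c; f \<in> D\<rbrakk> \<Longrightarrow> m (\<lambda>x. c * f x) = c * m f"
    and "\<lbrakk>f \<in> D; (g, h) \<in> R\<rbrakk> \<Longrightarrow> m (\<lambda>x. f x + g x) \<le> m (\<lambda>x. f x + h x)"
    and "f \<in> D \<Longrightarrow> m f + 1 \<le> m (\<lambda>x. f x + f0 x)"
  using assms unfolding admissible_def by blast+

lemma admissibleI:
  assumes "\<And>f. f \<notin> D \<Longrightarrow> m f = 0"
    and "\<And>f. f \<in> D \<Longrightarrow> m f \<le> p f"
    and "\<And>f g. \<lbrakk>f \<in> D; g \<in> D\<rbrakk> \<Longrightarrow> m (\<lambda>x. f x + g x) \<le> m f + m g"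
    and "\<And>c f. \<lbrakk>0 \<le> c; f \<in> D\<rbrakk> \<Longrightarrow> m (\<lambda>x. c * f x) = c * m f"
    and "\<And>f g h. \<lbrakk>f \<in> D; (g, h) \<in> R\<rbrakk> \<Longrightarrow> m (\<lambda>x. f x + g x) \<le> m (\<lambda>x. f x + h x)"
    and "\<And>f. f \<in> D \<Longrightarrow> m f + 1 \<le> m (\<lambda>x. f x + f0 x)"
  shows "admissible m"
  unfolding admissible_def
proof (intro conjI allI ballI impI)
  fix f and gh assume "f \<in> D" "gh \<in> R"
  then show "case gh of (g, h) \<Rightarrow> m (\<lambda>x. f x + g x) \<le> m (\<lambda>x. f x + h x)"
    using assms(5)[of f "fst gh" "snd gh"] by (cases gh) simp
qed (simp_all add: assms)

lemma admissible_zero: "admissible m \<Longrightarrow> m (\<lambda>_. 0) = 0"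
  using admissibleD(4)[of m 0 "\<lambda>_. 0"] D_zero by simp

lemma admissible_increasing:
  assumes "admissible m" "f \<in> D" "g \<in> D"
  shows "m f \<le> m (\<lambda>x. f x + g x)"
  using admissibleD(5)[OF assms(1,2) R_zero[OF assms(3)]] by simp

lemma admissible_nonneg:
  assumes "admissible m" shows "0 \<le> m f"
proof (cases "f \<in> D")
  case True
  then show ?thesis using admissible_increasing[OF assms D_zero, of f] admissible_zero[OF assms] by simp
qed (simp add: admissibleD(1)[OF assms])

text \<open>
  The largest sublinear functional below \<open>m\<close> that agrees with \<open>m\<close> at \<open>f\<close> and is additive along \<open>f\<close>.
  It is admissible whenever \<open>m\<close> is, so that a minimal admissible functional is additive along every \<open>f\<close>.
\<close>

definition absorb :: "(('x \<Rightarrow> real) \<Rightarrow> real) \<Rightarrow> ('x \<Rightarrow> real) \<Rightarrow> ('x \<Rightarrow> real) \<Rightarrow> real" where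
  "absorb m f g = (if g \<in> D then INF r\<in>{0..}. m (\<lambda>x. g x + r * f x) - r * m f else 0)"

lemma
  assumes m: "admissible m" and f: "f \<in> D" and g: "g \<in> D"
  shows absorb_lower: "0 \<le> r \<Longrightarrow> absorb m f g \<le> m (\<lambda>x. g x + r * f x) - r * m f"
    and absorb_greatest: "(\<And>r. 0 \<le> r \<Longrightarrow> c \<le> m (\<lambda>x. g x + r * f x) - r * m f) \<Longrightarrow> c \<le> absorb m f g"
proof -
  have "0 \<le> m (\<lambda>x. g x + r * f x) - r * m f" if "0 \<le> r" for r
    using admissible_increasing[OF m D_scale[OF that f] g] admissibleD(4)[OF m that f] by (simp add: add.commute)
  then have "bdd_below ((\<lambda>r. m (\<lambda>x. g x + r * f x) - r * m f) ` {0..})" by (intro bdd_belowI2[of _ 0]) auto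
  then show "0 \<le> r \<Longrightarrow> absorb m f g \<le> m (\<lambda>x. g x + r * f x) - r * m f"
    unfolding absorb_def using g by (auto intro: cINF_lower)
  show "(\<And>r. 0 \<le> r \<Longrightarrow> c \<le> m (\<lambda>x. g x + r * f x) - r * m f) \<Longrightarrow> c \<le> absorb m f g"
    unfolding absorb_def using g by (auto intro!: cINF_greatest)
qed

lemma absorb_le: "\<lbrakk>admissible m; f \<in> D\<rbrakk> \<Longrightarrow> absorb m f g \<le> m g"
  using absorb_lower[of m f g 0] by (cases "g \<in> D") (auto simp: absorb_def admissibleD(1))

lemma admissible_absorb:
  assumes m: "admissible m" and f: "f \<in> D"
  shows "admissible (absorb m f)"
proof (rule admissibleI)
  note lower = absorb_lower[OF m f] and greatest = absorb_greatest[OF m f]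
  show "absorb m f g = 0" if "g \<notin> D" for g using that by (simp add: absorb_def)
  show "absorb m f g \<le> p g" if "g \<in> D" for g
    using absorb_le[OF m f, of g] admissibleD(2)[OF m that] by linarith
  show "absorb m f (\<lambda>x. g x + h x) \<le> absorb m f g + absorb m f h" if g: "g \<in> D" and h: "h \<in> D" for g h
  proof -
    have "absorb m f (\<lambda>x. g x + h x) - absorb m f h \<le> m (\<lambda>x. g x + r * f x) - r * m f" if r: "0 \<le> r" for r
    proof -
      have "absorb m f (\<lambda>x. g x + h x) - (m (\<lambda>x. g x + r * f x) - r * m f) \<le> m (\<lambda>x. h x + q * f x) - q * m f"
        if q: "0 \<le> q" for q
      proof -
        have "absorb m f (\<lambda>x. g x + h x) \<le> m (\<lambda>x. (g x + h x) + (r + q) * f x) - (r + q) * m f"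
          using r q by (intro lower D_add g h) auto
        also have "(\<lambda>x. (g x + h x) + (r + q) * f x) = (\<lambda>x. (g x + r * f x) + (h x + q * f x))"
          by (simp add: algebra_simps)
        also have "m \<dots> \<le> m (\<lambda>x. g x + r * f x) + m (\<lambda>x. h x + q * f x)"
          by (intro admissibleD(3)[OF m] D_add D_scale g h f r q)
        finally show ?thesis by (simp add: algebra_simps)
      qed
      then have "absorb m f (\<lambda>x. g x + h x) - (m (\<lambda>x. g x + r * f x) - r * m f) \<le> absorb m f h"
        by (rule greatest[OF h])
      then show ?thesis by linarith
    qed
    then have "absorb m f (\<lambda>x. g x + h x) - absorb m f h \<le> absorb m f g" by (rule greatest[OF g])
    then show ?thesis by linarith
  qed
  show "absorb m f (\<lambda>x. c * g x) = c * absorb m f g" if c: "0 \<le> c" and g: "g \<in> D" for c g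
  proof (cases "c = 0")
    case True
    have "0 \<le> absorb m f (\<lambda>_. 0)"
      by (rule greatest[OF D_zero]) (simp add: admissibleD(4)[OF m _ f])
    then show ?thesis using absorb_le[OF m f, of "\<lambda>_. 0"] True by (simp add: admissible_zero[OF m])
  next
    case False
    then have c0: "0 < c" using c by simp
    have scale: "m (\<lambda>x. c * g x + c * r * f x) - c * r * m f = c * (m (\<lambda>x. g x + r * f x) - r * m f)"
      if "0 \<le> r" for r
      using admissibleD(4)[OF m c D_add[OF g D_scale[OF that f]]] by (simp add: algebra_simps)
    show ?thesis
    proof (rule antisym)
      have "absorb m f (\<lambda>x. c * g x) / c \<le> m (\<lambda>x. g x + r * f x) - r * m f" if "0 \<le> r" for r
        using lower[OF D_scale[OF c g], of "c * r"] scale[OF that] that c0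
        by (simp add: divide_le_eq mult.commute)
      then have "absorb m f (\<lambda>x. c * g x) / c \<le> absorb m f g" by (rule greatest[OF g])
      then show "absorb m f (\<lambda>x. c * g x) \<le> c * absorb m f g" using c0 by (simp add: divide_le_eq mult.commute)
      show "c * absorb m f g \<le> absorb m f (\<lambda>x. c * g x)"
      proof (rule greatest[OF D_scale[OF c g]])
        fix r :: real assume "0 \<le> r"
        then have "0 \<le> r / c" using c0 by simp
        then have "c * absorb m f g \<le> c * (m (\<lambda>x. g x + r / c * f x) - r / c * m f)"
          using c0 by (intro mult_left_mono lower g) auto
        also have "\<dots> = m (\<lambda>x. c * g x + r * f x) - r * m f"
          using scale[OF \<open>0 \<le> r / c\<close>] c0 by simp
        finally show "c * absorb m f g \<le> m (\<lambda>x. c * g x + r * f x) - r * m f" .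
      qed
    qed
  qed
  show "absorb m f (\<lambda>x. k x + g x) \<le> absorb m f (\<lambda>x. k x + h x)" if k: "k \<in> D" and gh: "(g, h) \<in> R" for k g h
  proof (rule greatest)
    show "(\<lambda>x. k x + h x) \<in> D" using k R_D[OF gh] D_add by blast
    fix r :: real assume r: "0 \<le> r"
    have "absorb m f (\<lambda>x. k x + g x) \<le> m (\<lambda>x. (k x + g x) + r * f x) - r * m f"
      using k R_D[OF gh] r by (intro lower D_add) auto
    also have "(\<lambda>x. (k x + g x) + r * f x) = (\<lambda>x. (k x + r * f x) + g x)" by (simp add: algebra_simps)
    also have "m \<dots> \<le> m (\<lambda>x. (k x + r * f x) + h x)"
      by (intro admissibleD(5)[OF m _ gh] D_add D_scale k f r)
    also have "(\<lambda>x. (k x + r * f x) + h x) = (\<lambda>x. (k x + h x) + r * f x)" by (simp add: algebra_simps)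
    finally show "absorb m f (\<lambda>x. k x + g x) \<le> m (\<lambda>x. (k x + h x) + r * f x) - r * m f" by simp
  qed
  show "absorb m f g + 1 \<le> absorb m f (\<lambda>x. g x + f0 x)" if g: "g \<in> D" for g
  proof (rule greatest[OF D_add[OF g f0]])
    fix r :: real assume r: "0 \<le> r"
    have "absorb m f g + 1 \<le> m (\<lambda>x. g x + r * f x) + 1 - r * m f"
      using lower[OF g r] by simp
    also have "m (\<lambda>x. g x + r * f x) + 1 \<le> m (\<lambda>x. (g x + r * f x) + f0 x)"
      by (intro admissibleD(6)[OF m] D_add D_scale g f r)
    also have "(\<lambda>x. (g x + r * f x) + f0 x) = (\<lambda>x. (g x + f0 x) + r * f x)" by (simp add: algebra_simps)
    finally show "absorb m f g + 1 \<le> m (\<lambda>x. (g x + f0 x) + r * f x) - r * m f" by simp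
  qed
qed

text \<open>
  Subadditivity is the only property for which the chain condition matters: of two members of the
  chain the smaller one serves for both summands.
\<close>

lemma admissible_INF_chain:
  assumes C: "C \<noteq> {}" "\<And>m. m \<in> C \<Longrightarrow> admissible m"
    and chain: "\<And>m n. \<lbrakk>m \<in> C; n \<in> C\<rbrakk> \<Longrightarrow> (\<forall>f. m f \<le> n f) \<or> (\<forall>f. n f \<le> m f)"
  shows "admissible (\<lambda>f. INF m\<in>C. m f)"
proof -
  let ?u = "\<lambda>f. INF m\<in>C. m f"
  have "bdd_below ((\<lambda>m. m f) ` C)" for f
    using admissible_nonneg[OF C(2)] by (intro bdd_belowI2[of _ 0]) auto
  then have lower: "?u f \<le> m f" if "m \<in> C" for m f using that by (intro cINF_lower)
  have greatest: "c \<le> ?u f" if "\<And>m. m \<in> C \<Longrightarrow> c \<le> m f" for c f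
    using C(1) that by (rule cINF_greatest)
  show ?thesis
  proof (rule admissibleI)
    show "?u f = 0" if "f \<notin> D" for f
    proof -
      have "(\<lambda>m. m f) ` C = {0}" using C that by (auto simp: admissibleD(1))
      then show ?thesis by simp
    qed
    show "?u f \<le> p f" if "f \<in> D" for f
      using C lower[of _ f] admissibleD(2)[OF C(2) that] by (metis ex_in_conv order_trans)
    show "?u (\<lambda>x. f x + g x) \<le> ?u f + ?u g" if f: "f \<in> D" and g: "g \<in> D" for f g
    proof -
      have *: "?u (\<lambda>x. f x + g x) \<le> m f + n g" if "m \<in> C" "n \<in> C" for m n
        using chain[OF that] lower[OF that(1), of "\<lambda>x. f x + g x"] lower[OF that(2), of "\<lambda>x. f x + g x"]
          admissibleD(3)[OF C(2)[OF that(1)] f g] admissibleD(3)[OF C(2)[OF that(2)] f g]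
        by (smt (verit))
      have "?u (\<lambda>x. f x + g x) - ?u g \<le> m f" if "m \<in> C" for m
      proof -
        have "?u (\<lambda>x. f x + g x) - m f \<le> ?u g" using *[OF that] by (intro greatest) (simp add: algebra_simps)
        then show ?thesis by linarith
      qed
      then have "?u (\<lambda>x. f x + g x) - ?u g \<le> ?u f" by (rule greatest)
      then show ?thesis by linarith
    qed
    show "?u (\<lambda>x. c * f x) = c * ?u f" if c: "0 \<le> c" and f: "f \<in> D" for c f
    proof (cases "c = 0")
      case True
      have "(\<lambda>m. m (\<lambda>x. 0)) ` C = {0}" using C by (auto simp: admissible_zero)
      then show ?thesis using True by simp
    next
      case False
      then have c0: "0 < c" using c by simp
      show ?thesis
      proof (rule antisym)
        have "?u (\<lambda>x. c * f x) / c \<le> m f" if "m \<in> C" for m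
          using lower[OF that, of "\<lambda>x. c * f x"] admissibleD(4)[OF C(2)[OF that] c f] c0
          by (simp add: divide_le_eq mult.commute)
        then have "?u (\<lambda>x. c * f x) / c \<le> ?u f" by (rule greatest)
        then show "?u (\<lambda>x. c * f x) \<le> c * ?u f" using c0 by (simp add: divide_le_eq mult.commute)
        show "c * ?u f \<le> ?u (\<lambda>x. c * f x)"
        proof (rule greatest)
          fix m assume "m \<in> C"
          then show "c * ?u f \<le> m (\<lambda>x. c * f x)"
            using mult_left_mono[OF lower[of m f] c] admissibleD(4)[OF C(2) c f] by simp
        qed
      qed
    qed
    show "?u (\<lambda>x. f x + g x) \<le> ?u (\<lambda>x. f x + h x)" if "f \<in> D" "(g, h) \<in> R" for f g h
      using lower[of _ "\<lambda>x. f x + g x"] admissibleD(5)[OF C(2) that]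
      by (intro greatest) (meson order_trans)
    show "?u f + 1 \<le> ?u (\<lambda>x. f x + f0 x)" if "f \<in> D" for f
      using lower[of _ f] admissibleD(6)[OF C(2) that] by (intro greatest) (smt (verit))
  qed
qed

lemma additive_minorant:
  assumes p: "admissible p"
  obtains m where "admissible m" "\<And>f g. \<lbrakk>f \<in> D; g \<in> D\<rbrakk> \<Longrightarrow> m (\<lambda>x. f x + g x) = m f + m g"
proof -
  let ?P = "\<lambda>m n :: ('x \<Rightarrow> real) \<Rightarrow> real. \<forall>f. n f \<le> m f"
  have "\<exists>m\<in>{m. admissible m}. \<forall>n\<in>{m. admissible m}. ?P m n \<longrightarrow> n = m"
  proof (rule predicate_Zorn)
    show "partial_order_on {m. admissible m} (relation_of ?P {m. admissible m})"
    proof (rule partial_order_on_relation_ofI)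
      fix m n assume "?P m n" "?P n m"
      then show "m = n" by (intro ext antisym) blast+
    qed (blast intro: order_trans order_refl)+
  next
    fix C assume C: "C \<in> Chains (relation_of ?P {m. admissible m})"
    then have g: "admissible m" if "m \<in> C" for m
      using that unfolding Chains_def relation_of_def by blast
    have ch: "(\<forall>f. m f \<le> n f) \<or> (\<forall>f. n f \<le> m f)" if "m \<in> C" "n \<in> C" for m n
      using C that unfolding Chains_def relation_of_def by blast
    show "\<exists>u\<in>{m. admissible m}. \<forall>m\<in>C. ?P m u"
    proof (cases "C = {}")
      case False
      have "bdd_below ((\<lambda>m. m f) ` C)" for f
        using admissible_nonneg[OF g] by (intro bdd_belowI2[of _ 0]) auto
      then have "\<forall>m\<in>C. ?P m (\<lambda>f. INF m\<in>C. m f)" 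
        by (intro ballI allI cINF_lower) assumption+
      moreover have "admissible (\<lambda>f. INF m\<in>C. m f)" using False g ch by (rule admissible_INF_chain)
      ultimately show ?thesis by (intro bexI[of _ "\<lambda>f. INF m\<in>C. m f"]) simp_all
    qed (use p in auto)
  qed
  then obtain m where m: "admissible m" and min: "\<And>n. admissible n \<Longrightarrow> (\<And>f. n f \<le> m f) \<Longrightarrow> n = m" by blast
  have "m (\<lambda>x. f x + g x) = m f + m g" if f: "f \<in> D" and g: "g \<in> D" for f g
  proof (rule antisym)
    have "absorb m g = m" by (rule min[OF admissible_absorb[OF m g] absorb_le[OF m g]])
    then have "m f \<le> m (\<lambda>x. f x + 1 * g x) - 1 * m g" using absorb_lower[OF m g f, of 1] by simp
    then show "m f + m g \<le> m (\<lambda>x. f x + g x)" by simp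
  qed (rule admissibleD(3)[OF m f g])
  with m show ?thesis by (rule that)
qed

end

section \<open>Continuous actions on compact metrizable spaces\<close>

locale compact_metrizable_action =
  fixes G :: "('g, 'b) monoid_scheme" and X :: "'x topology" and \<phi> :: "'g \<Rightarrow> 'x \<Rightarrow> 'x"
  assumes group: "group G" and compact: "compact_space X" and metrizable: "metrizable_space X"
    and action: "continuous_action G X \<phi>"
begin

lemma ga: "group_action G (topspace X) \<phi>"
  using action unfolding continuous_action_def by blast

lemma hausdorff: "Hausdorff_space X" and normal: "normal_space X"
  using metrizable metrizable_imp_normal_space metrizable_imp_Hausdorff_space by blast+

lemma act_closed: "g \<in> carrier G \<Longrightarrow> x \<in> topspace X \<Longrightarrow> \<phi> g x \<in> topspace X"
  using group_action.element_image[OF ga] by blast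

lemma act_inv: 
  assumes "g \<in> carrier G" "x \<in> topspace X"
  shows "\<phi> (inv\<^bsub>G\<^esub> g) (\<phi> g x) = x" "\<phi> g (\<phi> (inv\<^bsub>G\<^esub> g) x) = x"
proof -
  show *: "\<phi> (inv\<^bsub>G\<^esub> g) (\<phi> g x) = x"
    using group_action.orbit_sym_aux[OF ga] assms by blast
  show "\<phi> g (\<phi> (inv\<^bsub>G\<^esub> g) x) = x"
    using group_action.orbit_sym_aux[OF ga, of "inv\<^bsub>G\<^esub> g" x] assms group by (simp add: group.inv_inv)
qed

lemma act_mult:
  "\<lbrakk>g \<in> carrier G; h \<in> carrier G; x \<in> topspace X\<rbrakk> \<Longrightarrow> \<phi> (g \<otimes>\<^bsub>G\<^esub> h) x = \<phi> g (\<phi> h x)"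
  using group_action.composition_rule[OF ga] by blast

lemma act_one: "x \<in> topspace X \<Longrightarrow> \<phi> \<one>\<^bsub>G\<^esub> x = x"
  using group_action.id_eq_one[OF ga] by (metis restrict_apply')

lemma one_closed: "\<one>\<^bsub>G\<^esub> \<in> carrier G" and inv_closed: "g \<in> carrier G \<Longrightarrow> inv\<^bsub>G\<^esub> g \<in> carrier G"
  using group by (auto simp: group.is_monoid)

lemma act_continuous:
  assumes "g \<in> carrier G"
  shows "continuous_map X X (\<phi> g)"
proof -
  have "continuous_map X (prod_topology (discrete_topology (carrier G)) X) (\<lambda>x. (g, x))"
    using assms by (intro continuous_map_pairedI) auto
  then have "continuous_map X X ((\<lambda>(g, x). \<phi> g x) \<circ> (\<lambda>x. (g, x)))"
    using action unfolding continuous_action_def by (intro continuous_map_compose) auto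
  then show ?thesis by (simp add: o_def)
qed

lemma image_act_eq:
  assumes "g \<in> carrier G" "B \<subseteq> topspace X"
  shows "\<phi> g ` B = {y \<in> topspace X. \<phi> (inv\<^bsub>G\<^esub> g) y \<in> B}"
  using assms act_inv act_closed by (force simp: image_iff)

lemma open_image_act: 
  assumes "g \<in> carrier G" "openin X B"
  shows "openin X (\<phi> g ` B)"
  using openin_continuous_map_preimage[OF act_continuous[OF inv_closed[OF assms(1)]] assms(2)]
  by (simp add: image_act_eq[OF assms(1) openin_subset[OF assms(2)]])

lemma closed_image_act: 
  assumes "g \<in> carrier G" "closedin X B"
  shows "closedin X (\<phi> g ` B)"
  using closedin_continuous_map_preimage[OF act_continuous[OF inv_closed[OF assms(1)]] assms(2)]
  by (simp add: image_act_eq[OF assms(1) closedin_subset[OF assms(2)]])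

section \<open>Moving functions piece by piece\<close>

definition translate :: "'g \<Rightarrow> ('x \<Rightarrow> real) \<Rightarrow> 'x \<Rightarrow> real" where
  "translate g f = (\<lambda>x. f (\<phi> (inv\<^bsub>G\<^esub> g) x))"

lemma translate_nonneg_continuous: "g \<in> carrier G \<Longrightarrow> f \<in> nonneg_continuous X \<Longrightarrow> translate g f \<in> nonneg_continuous X"
  unfolding translate_def by (rule nonneg_continuous_comp[OF _ act_continuous[OF inv_closed]])

text \<open>
  One piece \<open>h s\<close> for each group element \<open>s\<close> is enough, because pieces that are moved by the same
  element can be added.
\<close>

definition transports :: "('x \<Rightarrow> real) \<Rightarrow> ('x \<Rightarrow> real) \<Rightarrow> bool" where
  "transports f w \<longleftrightarrow> (\<exists>T h. finite T \<and> T \<subseteq> carrier G \<and> (\<forall>s\<in>T. h s \<in> nonneg_continuous X) \<and>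
     (\<forall>x\<in>topspace X. f x = (\<Sum>s\<in>T. h s x)) \<and>
     (\<forall>y\<in>topspace X. (\<Sum>s\<in>T. translate s (h s) y) \<le> w y))"

lemma transportsI:
  assumes "finite T" "T \<subseteq> carrier G" "\<forall>s\<in>T. h s \<in> nonneg_continuous X"
    and "\<forall>x\<in>topspace X. f x = (\<Sum>s\<in>T. h s x)"
    and "\<forall>y\<in>topspace X. (\<Sum>s\<in>T. translate s (h s) y) \<le> w y"
  shows "transports f w"
  unfolding transports_def using assms by (intro exI[of _ T] exI[of _ h] conjI)

lemma transportsE:
  assumes "transports f w"
  obtains T h where "finite T" "T \<subseteq> carrier G" "\<forall>s\<in>T. h s \<in> nonneg_continuous X"
    "\<forall>x\<in>topspace X. f x = (\<Sum>s\<in>T. h s x)"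
    "\<forall>y\<in>topspace X. (\<Sum>s\<in>T. translate s (h s) y) \<le> w y"
  using assms unfolding transports_def by blast

lemma transports_self:
  assumes "f \<in> nonneg_continuous X" shows "transports f f"
  using assms act_one group
  by (intro transportsI[of "{\<one>\<^bsub>G\<^esub>}" "\<lambda>_. f"]) (auto simp: translate_def one_closed group.is_monoid monoid.inv_one)

lemma transports_nonneg:
  assumes "transports f w" "y \<in> topspace X"
  shows "0 \<le> w y"
proof -
  obtain T h where "finite T" "T \<subseteq> carrier G" "\<forall>s\<in>T. h s \<in> nonneg_continuous X"
     "\<forall>x\<in>topspace X. f x = (\<Sum>s\<in>T. h s x)" "\<forall>y\<in>topspace X. (\<Sum>s\<in>T. translate s (h s) y) \<le> w y"
    by (rule transportsE[OF assms(1)])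
  moreover from this have "0 \<le> (\<Sum>s\<in>T. translate s (h s) y)"
    using assms(2) translate_nonneg_continuous by (intro sum_nonneg) (meson nonneg_continuousD(2) subsetD)
  ultimately show ?thesis using assms(2) by fastforce
qed

lemma transports_add:
  assumes "transports f u" "transports g v"
  shows "transports (\<lambda>x. f x + g x) (\<lambda>x. u x + v x)"
proof -
  obtain S h where S: "finite S" "S \<subseteq> carrier G" "\<forall>s\<in>S. h s \<in> nonneg_continuous X"
     "\<forall>x\<in>topspace X. f x = (\<Sum>s\<in>S. h s x)" "\<forall>y\<in>topspace X. (\<Sum>s\<in>S. translate s (h s) y) \<le> u y"
    by (rule transportsE[OF assms(1)])
  obtain T k where T: "finite T" "T \<subseteq> carrier G" "\<forall>s\<in>T. k s \<in> nonneg_continuous X"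
     "\<forall>x\<in>topspace X. g x = (\<Sum>s\<in>T. k s x)" "\<forall>y\<in>topspace X. (\<Sum>s\<in>T. translate s (k s) y) \<le> v y"
    by (rule transportsE[OF assms(2)])
  define m where "m = (\<lambda>s x. (if s \<in> S then h s x else 0) + (if s \<in> T then k s x else 0))"
  have sum_eq: "(\<Sum>s\<in>S \<union> T. m s (p s)) = (\<Sum>s\<in>S. h s (p s)) + (\<Sum>s\<in>T. k s (p s))" for p
  proof -
    have "(\<Sum>s\<in>S \<union> T. if s \<in> S then h s (p s) else 0) = (\<Sum>s\<in>S. h s (p s))"
      "(\<Sum>s\<in>S \<union> T. if s \<in> T then k s (p s) else 0) = (\<Sum>s\<in>T. k s (p s))"
      using S(1) T(1) by (simp_all flip: sum.inter_restrict add: Int_absorb1 Int_absorb2 inf_sup_absorb)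
    then show ?thesis unfolding m_def by (simp add: sum.distrib)
  qed
  have "m s \<in> nonneg_continuous X" if "s \<in> S \<union> T" for s
    unfolding m_def using S(3) T(3) that
    by (cases "s \<in> S"; cases "s \<in> T")
       (auto simp: nonneg_continuous_const intro: nonneg_continuous_add)
  moreover have "\<forall>x\<in>topspace X. f x + g x = (\<Sum>s\<in>S \<union> T. m s x)"
    using S(4) T(4) sum_eq[of "\<lambda>_. x" for x] by simp
  moreover have "\<forall>y\<in>topspace X. (\<Sum>s\<in>S \<union> T. translate s (m s) y) \<le> u y + v y"
    using S(5) T(5) sum_eq[of "\<lambda>s. \<phi> (inv\<^bsub>G\<^esub> s) y" for y] unfolding translate_def by (simp add: add_mono)
  ultimately show ?thesis using S T
    by (intro transportsI[of "S \<union> T" m]) auto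
qed

lemma transports_sum:
  assumes "finite I" "\<And>i. i \<in> I \<Longrightarrow> transports (f i) (w i)"
  shows "transports (\<lambda>x. \<Sum>i\<in>I. f i x) (\<lambda>x. \<Sum>i\<in>I. w i x)"
  using assms
proof (induction I)
  case empty
  then show ?case using transports_self[OF nonneg_continuous_const[of 0]] by simp
next
  case (insert i I)
  then show ?case using transports_add[of "f i" "w i"] by simp
qed

lemma transports_cmult:
  assumes "0 \<le> c" "transports f w"
  shows "transports (\<lambda>x. c * f x) (\<lambda>x. c * w x)"
proof -
  obtain S h where S: "finite S" "S \<subseteq> carrier G" "\<forall>s\<in>S. h s \<in> nonneg_continuous X"
     "\<forall>x\<in>topspace X. f x = (\<Sum>s\<in>S. h s x)" "\<forall>y\<in>topspace X. (\<Sum>s\<in>S. translate s (h s) y) \<le> w y"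
    by (rule transportsE[OF assms(2)])
  have "\<forall>s\<in>S. (\<lambda>x. c * h s x) \<in> nonneg_continuous X"
    using S(3) assms(1) by (auto intro: nonneg_continuous_cmult)
  moreover have "\<forall>y\<in>topspace X. (\<Sum>s\<in>S. translate s (\<lambda>x. c * h s x) y) \<le> c * w y"
    using S(5) assms(1) by (simp add: translate_def mult_left_mono flip: sum_distrib_left)
  moreover have "\<forall>x\<in>topspace X. c * f x = (\<Sum>s\<in>S. c * h s x)"
    using S(4) by (simp flip: sum_distrib_left)
  ultimately show ?thesis using S(1,2) by (intro transportsI[of S "\<lambda>s x. c * h s x"])
qed

lemma transports_cong:
  assumes "transports f w" "\<And>x. x \<in> topspace X \<Longrightarrow> g x = f x" "\<And>y. y \<in> topspace X \<Longrightarrow> w y \<le> v y"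
  shows "transports g v"
proof -
  obtain S h where S: "finite S" "S \<subseteq> carrier G" "\<forall>s\<in>S. h s \<in> nonneg_continuous X"
     "\<forall>x\<in>topspace X. f x = (\<Sum>s\<in>S. h s x)" "\<forall>y\<in>topspace X. (\<Sum>s\<in>S. translate s (h s) y) \<le> w y"
    by (rule transportsE[OF assms(1)])
  have "\<forall>x\<in>topspace X. g x = (\<Sum>s\<in>S. h s x)" using S(4) assms(2) by simp
  moreover have "\<forall>y\<in>topspace X. (\<Sum>s\<in>S. translate s (h s) y) \<le> v y"
    using S(5) assms(3) by (blast intro: order_trans)
  ultimately show ?thesis using S(1-3) by (intro transportsI[of S h])
qed

lemma transports_nonneg_continuous:
  assumes "transports f w"
  shows "f \<in> nonneg_continuous X"
proof -
  obtain S h where S: "finite S" "S \<subseteq> carrier G" "\<forall>s\<in>S. h s \<in> nonneg_continuous X"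
     "\<forall>x\<in>topspace X. f x = (\<Sum>s\<in>S. h s x)" "\<forall>y\<in>topspace X. (\<Sum>s\<in>S. translate s (h s) y) \<le> w y"
    by (rule transportsE[OF assms])
  have "(\<lambda>x. \<Sum>s\<in>S. h s x) \<in> nonneg_continuous X" using S by (intro nonneg_continuous_sum) auto
  then show ?thesis using S(4) continuous_map_eq[of X euclideanreal "\<lambda>x. \<Sum>s\<in>S. h s x" f]
    unfolding nonneg_continuous_def by auto
qed

text \<open>
  Whatever transports a sum transports its summands separately, with targets that fit into the old
  one together. This makes functionals defined through transport invariant under translating a single
  summand.
\<close>

lemma transports_split:
  assumes f: "f \<in> nonneg_continuous X" and g: "g \<in> nonneg_continuous X"
    and tr: "transports (\<lambda>x. f x + g x) w"
  obtains u v where "transports f u" "transports g v" "\<And>y. y \<in> topspace X \<Longrightarrow> u y + v y \<le> w y"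
proof -
  obtain S h where S: "finite S" "S \<subseteq> carrier G" "\<forall>s\<in>S. h s \<in> nonneg_continuous X"
     "\<forall>x\<in>topspace X. f x + g x = (\<Sum>s\<in>S. h s x)" "\<forall>y\<in>topspace X. (\<Sum>s\<in>S. translate s (h s) y) \<le> w y"
    by (rule transportsE[OF tr])
  have "f x \<le> (\<Sum>s\<in>S. h s x)" if "x \<in> topspace X" for x
    using S(4) nonneg_continuousD(2)[OF g that] that by (metis le_add_same_cancel1)
  then obtain k where k: "\<forall>s\<in>S. k s \<in> nonneg_continuous X \<and> (\<forall>x\<in>topspace X. k s x \<le> h s x)"
    "\<forall>x\<in>topspace X. f x = (\<Sum>s\<in>S. k s x)"
    using riesz_decomposition[OF S(1) _ f, of h] S(3) by metis
  define l where "l = (\<lambda>s x. h s x - k s x)"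
  have l: "\<forall>s\<in>S. l s \<in> nonneg_continuous X"
    using S(3) k(1) unfolding l_def by (auto intro: nonneg_continuous_diff)
  have gl: "\<forall>x\<in>topspace X. g x = (\<Sum>s\<in>S. l s x)"
    unfolding l_def sum_subtractf using S(4) k(2) by force
  show ?thesis
  proof
    show "transports f (\<lambda>y. \<Sum>s\<in>S. translate s (k s) y)"
      using S(1,2) k by (intro transportsI[of S k]) auto
    show "transports g (\<lambda>y. \<Sum>s\<in>S. translate s (l s) y)"
      using S(1,2) l gl by (intro transportsI[of S l]) auto
    show "(\<Sum>s\<in>S. translate s (k s) y) + (\<Sum>s\<in>S. translate s (l s) y) \<le> w y" if "y \<in> topspace X" for y
      using S(5) that by (simp add: l_def translate_def flip: sum.distrib)
  qed
qed

lemma transports_le: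
  assumes f: "f \<in> nonneg_continuous X" and le: "\<And>x. x \<in> topspace X \<Longrightarrow> f x \<le> g x" and tr: "transports g w"
  shows "transports f w"
proof -
  have "(\<lambda>x. g x - f x) \<in> nonneg_continuous X"
    using f le transports_nonneg_continuous[OF tr] by (intro nonneg_continuous_diff) auto
  then obtain u v where uv: "transports f u" "transports (\<lambda>x. g x - f x) v" "\<And>y. y \<in> topspace X \<Longrightarrow> u y + v y \<le> w y"
    using transports_split[OF f, of "\<lambda>x. g x - f x" w] tr by auto
  show ?thesis
  proof (rule transports_cong[OF uv(1)])
    fix y assume "y \<in> topspace X"
    then show "u y \<le> w y" using uv(3)[of y] transports_nonneg[OF uv(2), of y] by linarith
  qed simp
qed

lemma transports_translate:
  assumes a: "a \<in> carrier G" and tr: "transports f w"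
  shows "transports (translate a f) w"
proof -
  interpret group G by (rule group)
  obtain S h where S: "finite S" "S \<subseteq> carrier G" "\<forall>s\<in>S. h s \<in> nonneg_continuous X"
     "\<forall>x\<in>topspace X. f x = (\<Sum>s\<in>S. h s x)" "\<forall>y\<in>topspace X. (\<Sum>s\<in>S. translate s (h s) y) \<le> w y"
    by (rule transportsE[OF tr])
  let ?r = "\<lambda>s. s \<otimes>\<^bsub>G\<^esub> inv\<^bsub>G\<^esub> a"
  define k where "k = (\<lambda>u. translate a (h (u \<otimes>\<^bsub>G\<^esub> a)))"
  have inj: "inj_on ?r S" using S(2) a by (auto simp: inj_on_def subset_iff)
  have ra: "?r s \<otimes>\<^bsub>G\<^esub> a = s" if "s \<in> S" for s
    using S(2) a that by (simp add: m_assoc subset_iff)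
  have 1: "\<forall>u\<in>?r ` S. k u \<in> nonneg_continuous X"
    using S(3) ra a by (auto simp: k_def intro: translate_nonneg_continuous)
  have 2: "translate a f x = (\<Sum>u\<in>?r ` S. k u x)" if "x \<in> topspace X" for x
  proof -
    have "(\<Sum>u\<in>?r ` S. k u x) = (\<Sum>s\<in>S. h s (\<phi> (inv\<^bsub>G\<^esub> a) x))"
      unfolding sum.reindex[OF inj] by (rule sum.cong) (simp_all add: k_def translate_def ra)
    then show ?thesis using S(4) act_closed[OF inv_closed[OF a] that] by (simp add: translate_def)
  qed
  have 3: "(\<Sum>u\<in>?r ` S. translate u (k u) y) \<le> w y" if "y \<in> topspace X" for y
  proof -
    have "translate (?r s) (k (?r s)) y = translate s (h s) y" if s: "s \<in> S" for s
    proof -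
      have "\<phi> (inv\<^bsub>G\<^esub> a) (\<phi> (inv\<^bsub>G\<^esub> (?r s)) y) = \<phi> (inv\<^bsub>G\<^esub> s) y"
        using S(2) s a \<open>y \<in> topspace X\<close>
        by (simp add: subset_iff inv_mult_group act_mult act_closed act_inv)
      then show ?thesis by (simp add: translate_def k_def ra s)
    qed
    then have "(\<Sum>u\<in>?r ` S. translate u (k u) y) = (\<Sum>s\<in>S. translate s (h s) y)"
      unfolding sum.reindex[OF inj] by (intro sum.cong) simp_all
    then show ?thesis using S(5) that by simp
  qed
  show ?thesis
    using S(1,2) a 1 2 3 by (intro transportsI[of "?r ` S" k]) auto
qed

text \<open>
  If \<open>x = g z\<close> with \<open>z \<in> B\<close>, the translate by \<open>g\<close> of a Urysohn function for \<open>z\<close> and \<open>B\<close> is such a bump.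
\<close>

lemma bump_transports_indicator:
  assumes B: "openin X B" and x: "x \<in> saturation G \<phi> B"
  obtains b where "transports b (indicator B)" "b x > 1/2"
proof -
  obtain g z where g: "g \<in> carrier G" "z \<in> B" "x = \<phi> g z"
    using x unfolding saturation_def by blast
  have z: "z \<in> topspace X" using B g openin_subset by blast
  have "closedin X {z}" "closedin X (topspace X - B)" "disjnt (topspace X - B) {z}"
    using z B g hausdorff by (auto simp: closedin_Hausdorff_sing_eq)
  then obtain q where q: "continuous_map X (top_of_set {0..1::real}) q" "q ` (topspace X - B) \<subseteq> {0}" "q ` {z} \<subseteq> {1}"
    using Urysohn_lemma[OF normal, of "topspace X - B" "{z}" 0 1] by auto
  have qi: "continuous_map X euclideanreal q" "\<And>y. y \<in> topspace X \<Longrightarrow> 0 \<le> q y \<and> q y \<le> 1"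
    using q(1) by (auto simp: continuous_map_in_subtopology)
  have "transports q q" using qi by (intro transports_self nonneg_continuousI) auto
  then have "transports q (indicator B)"
  proof (rule transports_cong)
    show "q y \<le> indicator B y" if "y \<in> topspace X" for y
      using that q(2) qi by (auto simp: indicator_def)
  qed simp
  then have "transports (translate g q) (indicator B)" using g by (intro transports_translate)
  moreover have "translate g q x > 1/2"
    using g z q(3) by (simp add: translate_def act_inv)
  ultimately show ?thesis by (rule that)
qed

text \<open>
  Finitely many bumps that exceed \<open>1/2\<close> cover the support, so a multiple of their sum
  dominates \<open>f\<close>.
\<close>

lemma compact_support_transports:
  assumes B: "openin X B" and f: "f \<in> nonneg_continuous X"
    and K: "closedin X K" "K \<subseteq> saturation G \<phi> B" "\<And>x. x \<in> topspace X - K \<Longrightarrow> f x = 0"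
  shows "\<exists>t\<ge>0. transports f (\<lambda>y. t * indicator B y)"
proof -
  have "\<exists>b. transports b (indicator B) \<and> b x > 1/2" if "x \<in> K" for x
    using bump_transports_indicator[OF B, of x] K(2) that by blast
  then obtain b where b: "\<And>x. x \<in> K \<Longrightarrow> transports (b x) (indicator B)" "\<And>x. x \<in> K \<Longrightarrow> b x x > 1/2"
    by metis
  have KX: "K \<subseteq> topspace X" using K(1) closedin_subset by blast
  define W where "W = (\<lambda>x. {y \<in> topspace X. b x y > 1/2})"
  have "openin X (W x)" if "x \<in> K" for x
    using nonneg_continuousD(1)[OF transports_nonneg_continuous[OF b(1)[OF that]]]
    unfolding W_def continuous_map_upper_lower_semicontinuous_lt by blast
  moreover have "K \<subseteq> \<Union> (W ` K)" using b(2) KX unfolding W_def by auto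
  moreover have "compactin X K" using K(1) compact closedin_compact_space by blast
  ultimately obtain \<F> where F: "finite \<F>" "\<F> \<subseteq> W ` K" "K \<subseteq> \<Union>\<F>"
    unfolding compactin_def by (metis (no_types, lifting) imageE)
  then obtain I where I: "finite I" "I \<subseteq> K" "\<F> = W ` I" by (meson finite_subset_image)
  have "compactin euclideanreal (f ` topspace X)"
    using f compact image_compactin unfolding nonneg_continuous_def compact_space_def by blast
  then have "bounded (f ` topspace X)" by (simp add: compact_imp_bounded)
  then obtain C where C: "C > 0" "\<And>x. x \<in> topspace X \<Longrightarrow> \<bar>f x\<bar> \<le> C"
    unfolding bounded_pos by auto
  have tr: "transports (\<lambda>x. 2 * C * (\<Sum>i\<in>I. b i x)) (\<lambda>y. 2 * C * (\<Sum>i\<in>I. indicator B y))"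
    using C I b by (intro transports_cmult transports_sum) auto
  have bn: "0 \<le> b i x" if "i \<in> I" "x \<in> topspace X" for i x
    using nonneg_continuousD(2)[OF transports_nonneg_continuous[OF b(1)]] that I by blast
  have le: "f x \<le> 2 * C * (\<Sum>i\<in>I. b i x)" if x: "x \<in> topspace X" for x
  proof (cases "x \<in> K")
    case True
    then obtain i where i: "i \<in> I" "x \<in> W i" using F I by blast
    then have "1/2 \<le> b i x" unfolding W_def by simp
    also have "\<dots> \<le> (\<Sum>i\<in>I. b i x)" using bn I i x by (intro member_le_sum) auto
    finally have "C * 1 \<le> C * (2 * (\<Sum>i\<in>I. b i x))" using C(1) by (intro mult_left_mono) auto
    then show ?thesis using C(2)[OF x] by (simp add: mult.assoc mult.left_commute)
  next
    case False
    then show ?thesis using K(3) x C(1) bn by (auto intro!: mult_nonneg_nonneg sum_nonneg)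
  qed
  have "transports f (\<lambda>y. 2 * C * (\<Sum>i\<in>I. indicator B y))"
    by (rule transports_le[OF f le tr])
  then show ?thesis using C(1)
    by (intro exI[of _ "2 * C * card I"]) (auto elim!: transports_cong)
qed

section \<open>From functions back to open sets\<close>

text \<open>
  Write \<open>H\<^sub>0, H\<^sub>1, \<dots>\<close> for the pieces, \<open>e\<^sub>0, e\<^sub>1, \<dots>\<close> for the elements moving them, and
  \<open>N = n + 1\<close>. Over a source point \<open>x\<close> the piece \<open>j\<close> occupies the heights from \<open>a\<^sub>j x\<close> to \<open>a\<^sub>j\<^sub>+\<^sub>1 x\<close>, an
  interval of length \<open>N H\<^sub>j x\<close>; over a target point \<open>y\<close> it starts at \<open>b\<^sub>j y\<close>, where each piece is given two
  units of room beyond its own length. The copy \<open>c\<close> of the source set sits at height \<open>c - 1\<close>. The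
  condition \<open>P c j x\<close> says that this height meets the piece \<open>j\<close>, after the piece has been lengthened
  downwards by one unit so that neighbouring pieces overlap; the copy then arrives at height
  \<open>L c j x\<close> over \<open>e\<^sub>j x\<close>. The level \<open>l\<close> of the target consists of the heights strictly between \<open>lam l\<close>
  and \<open>lam l + 1\<close>. As \<open>lam < 1\<close>, the levels cover all positive heights. As a level has length
  \<open>1\<close> and distinct arrivals over one point differ in height by at least \<open>1\<close>, no level receives two of them.
\<close>

lemma transports_imp_dyn_subeq_mult:
  assumes "openin X O'" and BX: "B \<subseteq> topspace X" and t: "0 \<le> t" "t < 1"
    and tr: "transports f (\<lambda>y. t * indicator B y)"
    and f1: "\<And>x. x \<in> O' \<Longrightarrow> 1 \<le> f x"
  shows "\<exists>n\<ge>1. dyn_subeq_mult G X \<phi> (n + 1) O' n B"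
proof -
  obtain T h where T: "finite T" "T \<subseteq> carrier G" "\<forall>s\<in>T. h s \<in> nonneg_continuous X"
     "\<forall>x\<in>topspace X. f x = (\<Sum>s\<in>T. h s x)"
     "\<forall>y\<in>topspace X. (\<Sum>s\<in>T. translate s (h s) y) \<le> t * indicator B y"
    by (rule transportsE[OF tr])
  obtain e and J :: nat where e: "bij_betw e {..<J} T"
    using ex_bij_betw_nat_finite[OF T(1)] unfolding atLeast0LessThan by blast
  have eT: "e i \<in> T" if "i < J" for i using e that by (auto simp: bij_betw_def)
  have eG: "e i \<in> carrier G" if "i < J" for i using eT[OF that] T(2) by blast
  define H where "H = (\<lambda>i. h (e i))"
  have Hnc: "H i \<in> nonneg_continuous X" if "i < J" for i using T(3) eT[OF that] by (simp add: H_def)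
  have Hsum: "f x = (\<Sum>i<J. H i x)" if "x \<in> topspace X" for x
    using T(4) that sum.reindex_bij_betw[OF e, of "\<lambda>s. h s x"] by (simp add: H_def)
  have HB: "(\<Sum>i<J. translate (e i) (H i) y) \<le> t * indicator B y" if "y \<in> topspace X" for y
    using T(5) that sum.reindex_bij_betw[OF e, of "\<lambda>s. translate s (h s) y"] by (simp add: H_def)
  \<comment> \<open>Any number strictly between \<open>t\<close> and \<open>1\<close> would do; \<open>n\<close> is chosen so large that the target
    stack, of height at most \<open>(n + 1) t + 2 J\<close>, fits into \<open>n\<close> levels.\<close>
  define lam where "lam = (1 + t) / 2"
  have lam: "t < lam" "lam < 1" "0 < lam" using t by (auto simp: lam_def)
  obtain m :: nat where m: "(t + 2 * real J) / (lam - t) < real m" using reals_Archimedean2 by blast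
  define n where "n = Suc m"
  have n1: "n \<ge> 1" by (simp add: n_def)
  have "(t + 2 * real J) / (lam - t) < real n" using m by (simp add: n_def)
  then have n: "real (n + 1) * t + 2 * real J \<le> lam * real n"
    using lam by (simp add: field_simps)
  define N where "N = real (n + 1)"
  have N0: "0 < N" by (simp add: N_def)
  define a where "a = (\<lambda>j x. N * (\<Sum>i<j. H i x))"
  define b where "b = (\<lambda>j y. \<Sum>i<j. N * translate (e i) (H i) y + 2)"
  define L where "L = (\<lambda>(c::nat) j x. b j (\<phi> (e j) x) + real c - a j x)"
  define P where "P = (\<lambda>(c::nat) j x. x \<in> topspace X \<and> 0 < H j x \<and> a j x < real c \<and> real c - 1 < a (Suc j) x)"
  define U where "U = (\<lambda>(c::nat) j (l::nat).
     {x. P c j x \<and> lam * real l < L c j x \<and> L c j x < lam * real l + 1})"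
  have tn: "0 \<le> translate (e i) (H i) y" if "i < J" "y \<in> topspace X" for i y
    using nonneg_continuousD(2)[OF translate_nonneg_continuous[OF eG[OF that(1)] Hnc[OF that(1)]] that(2)] .
  have acont: "continuous_map X euclideanreal (a j)" if "j \<le> J" for j
    unfolding a_def using that
    by (intro continuous_map_real_mult_left continuous_map_sum nonneg_continuousD(1)[OF Hnc]) auto
  have bcont: "continuous_map X euclideanreal (b j)" if "j \<le> J" for j
    unfolding b_def using that
    by (intro continuous_map_sum continuous_map_add continuous_map_real_mult_left
        nonneg_continuousD(1)[OF translate_nonneg_continuous[OF eG Hnc]]) auto
  have Lcont: "continuous_map X euclideanreal (L c j)" if "j < J" for c j
  proof -
    have "continuous_map X euclideanreal (b j \<circ> \<phi> (e j))"
      using that by (intro continuous_map_compose[OF act_continuous[OF eG]] bcont) auto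
    then have "continuous_map X euclideanreal (\<lambda>x. b j (\<phi> (e j) x))" by (simp add: o_def)
    then show ?thesis
      unfolding L_def using that by (intro continuous_map_diff continuous_map_add acont) auto
  qed
  have Uopen: "openin X (U c j l)" if "j < J" for c j l
  proof -
    have gt: "openin X {x \<in> topspace X. r < g x}" and lt: "openin X {x \<in> topspace X. g x < r}"
      if "continuous_map X euclideanreal g" for r g
      using that unfolding continuous_map_upper_lower_semicontinuous_lt by blast+
    have eq: "U c j l = {x \<in> topspace X. 0 < H j x} \<inter> {x \<in> topspace X. a j x < real c} \<inter>
        {x \<in> topspace X. real c - 1 < a (Suc j) x} \<inter>
        ({x \<in> topspace X. lam * real l < L c j x} \<inter> {x \<in> topspace X. L c j x < lam * real l + 1})"
      unfolding U_def P_def by auto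
    show ?thesis
      unfolding eq using that by (intro openin_Int gt lt acont Lcont nonneg_continuousD(1)[OF Hnc]) auto
  qed
  have tHx: "translate (e j) (H j) (\<phi> (e j) x) = H j x" if "j < J" "x \<in> topspace X" for j x
    using act_inv(1)[OF eG] that by (simp add: translate_def)
  have UB: "\<phi> (e j) x \<in> B" if "P c j x" "j < J" for c j x
  proof -
    have x: "x \<in> topspace X" "0 < H j x" using that(1) by (auto simp: P_def)
    have yX: "\<phi> (e j) x \<in> topspace X" using act_closed[OF eG] that(2) x by blast
    have "H j x \<le> (\<Sum>i<J. translate (e i) (H i) (\<phi> (e j) x))"
      using member_le_sum[of j "{..<J}" "\<lambda>i. translate (e i) (H i) (\<phi> (e j) x)"] tHx tn yX that(2) x(1)
      by simp
    also have "\<dots> \<le> t * indicator B (\<phi> (e j) x)" by (rule HB[OF yX])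
    finally show ?thesis using x(2) by (cases "\<phi> (e j) x \<in> B") auto
  qed
  have bSuc: "b (Suc j) y = b j y + N * translate (e j) (H j) y + 2" for j y by (simp add: b_def)
  have bmono: "b j y \<le> b j' y" if "j \<le> j'" "j' \<le> J" "y \<in> topspace X" for j j' y
    unfolding b_def using that tn N0 by (intro sum_mono2) auto
  have b0: "0 \<le> b j y" if "j \<le> J" "y \<in> topspace X" for j y
    using bmono[of 0 j y] that by (simp add: b_def)
  have Lup: "L c j x < b (Suc j) (\<phi> (e j) x) - 1" if "P c j x" "j < J" for c j x
    using that tHx[of j x] unfolding bSuc L_def P_def by (auto simp: a_def algebra_simps)
  have Llow: "b j (\<phi> (e j) x) < L c j x" if "P c j x" for c j x
    using that unfolding L_def P_def by auto
  have sep: "L c j x + 1 < L c' j' x'"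
    if "P c j x" "P c' j' x'" "j < j'" "j' < J" "\<phi> (e j) x = \<phi> (e j') x'" for c c' j j' x x'
  proof -
    have jJ: "j < J" using that by simp
    have y: "\<phi> (e j) x \<in> topspace X" using that(1) act_closed[OF eG[OF jJ]] unfolding P_def by blast
    have "b (Suc j) (\<phi> (e j) x) \<le> b j' (\<phi> (e j) x)" using that by (intro bmono y) auto
    moreover have "b j' (\<phi> (e j) x) < L c' j' x'" using Llow[OF that(2)] that(5) by simp
    ultimately show ?thesis using Lup[OF that(1) jJ] by linarith
  qed
  have uniq: "c = c' \<and> j = j'"
    if "x \<in> U c j l" "x' \<in> U c' j' l" "j < J" "j' < J" "\<phi> (e j) x = \<phi> (e j') x'" for c c' j j' l x x'
  proof -
    have P: "P c j x" "P c' j' x'" and d: "\<bar>L c j x - L c' j' x'\<bar> < 1"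
      using that(1,2) by (auto simp: U_def)
    have "\<not> j < j'" using sep[OF P _ that(4,5)] d by auto
    moreover have "\<not> j' < j" using sep[OF P(2,1) _ that(3) that(5)[symmetric]] d by auto
    ultimately have jj: "j = j'" by simp
    have "x \<in> topspace X" "x' \<in> topspace X" using P unfolding P_def by blast+
    then have "x = x'"
      using act_inv(1)[OF eG[OF that(3)]] that(5) unfolding jj by metis
    then have "\<bar>real c - real c'\<bar> < 1" using d jj by (simp add: L_def)
    then show ?thesis using jj by simp
  qed
  have cover: "\<exists>j<J. \<exists>l<n. x \<in> U c j l" if x: "x \<in> O'" and c: "c \<in> {1..n + 1}" for x c
  proof -
    have xX: "x \<in> topspace X" using assms(1) x openin_subset by blast
    have "N \<le> a J x" using f1[OF x] Hsum[OF xX] N0 by (simp add: a_def)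
    then have ex: "real c - 1 < a J x" using c by (auto simp: N_def)
    \<comment> \<open>The first piece whose top lies above the height \<open>c - 1\<close>; it has positive length there, although
      earlier pieces may be empty.\<close>
    define j where "j = (LEAST j. real c - 1 < a (Suc j) x)"
    have a0: "a 0 x \<le> real c - 1" using c by (simp add: a_def)
    then have "J \<noteq> 0" using ex by (metis not_less)
    then have exj: "real c - 1 < a (Suc (J - 1)) x" using ex by simp
    have j1: "real c - 1 < a (Suc j) x" unfolding j_def by (rule LeastI[of _ "J - 1"]) (rule exj)
    have "j \<le> J - 1" unfolding j_def by (rule Least_le) (rule exj)
    then have jJ: "j < J" using \<open>J \<noteq> 0\<close> by simp
    have j2: "a j x \<le> real c - 1"
    proof (cases j)
      case (Suc i)
      then have "\<not> real c - 1 < a (Suc i) x" using not_less_Least[of i "\<lambda>j. real c - 1 < a (Suc j) x"] by (simp add: j_def)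
      then show ?thesis using Suc by simp
    qed (use a0 in simp)
    have "0 < N * H j x" using j1 j2 by (simp add: a_def algebra_simps)
    then have "0 < H j x" using N0 by (simp add: zero_less_mult_iff)
    then have P: "P c j x" using xX j1 j2 by (simp add: P_def)
    let ?y = "\<phi> (e j) x"
    have yX: "?y \<in> topspace X" using act_closed[OF eG[OF jJ] xX] .
    have L0: "0 < L c j x" using Llow[OF P] b0[of j ?y] jJ yX by simp
    have "L c j x \<le> b J ?y" using Lup[OF P jJ] bmono[of "Suc j" J ?y] jJ yX by simp
    also have "\<dots> = N * (\<Sum>i<J. translate (e i) (H i) ?y) + 2 * real J"
      by (simp add: b_def sum.distrib sum_distrib_left)
    also have "\<dots> \<le> N * t + 2 * real J"
    proof -
      have "(\<Sum>i<J. translate (e i) (H i) ?y) \<le> t"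
        using HB[OF yX] t by (cases "?y \<in> B") auto
      then show ?thesis using N0 by simp
    qed
    also have "\<dots> \<le> lam * real n" using n by (simp add: N_def)
    finally have Ln: "L c j x / lam \<le> real n" using lam by (simp add: field_simps)
    \<comment> \<open>The level with \<open>lam l < L c j x \<le> lam (l + 1)\<close>.\<close>
    define l where "l = nat (\<lceil>L c j x / lam\<rceil> - 1)"
    have "0 < L c j x / lam" using L0 lam by simp
    then have "0 < \<lceil>L c j x / lam\<rceil>" by simp
    then have lr: "real l = of_int \<lceil>L c j x / lam\<rceil> - 1" by (simp add: l_def)
    have "\<lceil>L c j x / lam\<rceil> \<le> int n" using Ln by (simp add: ceiling_le_iff)
    then have "real_of_int \<lceil>L c j x / lam\<rceil> \<le> real n" by (metis of_int_le_iff of_int_of_nat_eq)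
    then have ln: "l < n" using lr by linarith
    have "real l < L c j x / lam" "L c j x / lam \<le> real l + 1"
      using lr by linarith+
    then have "lam * real l < L c j x" "L c j x \<le> lam * real l + lam"
      using lam by (simp_all add: field_simps)
    then have "x \<in> U c j l" using P lam by (simp add: U_def)
    then show ?thesis using jJ ln by blast
  qed
  have "dyn_subeq_mult G X \<phi> (n + 1) O' n B"
    unfolding dyn_subeq_mult_def dyn_subeq_def
  proof (intro allI impI)
    fix F assume F: "\<forall>i\<in>{1..n + 1}. closedin X (F i) \<and> F i \<subseteq> O'"
    \<comment> \<open>The pairs (piece, level) are numbered from \<open>1\<close> by \<open>q = j n + l + 1\<close>.\<close>
    let ?j = "\<lambda>q. (q - 1) div n" and ?l = "\<lambda>q. (q - 1) mod n"
    have jl: "?j q < J" "?l q < n" if "q \<in> {1..J * n}" for q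
      using that n1 by (auto simp: less_mult_imp_div_less mult.commute)
    have code: "\<exists>q\<in>{1..J * n}. ?j q = j \<and> ?l q = l" if "j < J" "l < n" for j l
    proof (rule bexI[of _ "Suc (j * n + l)"])
      have "Suc j * n \<le> J * n" using that(1) by (intro mult_right_mono) auto
      then show "Suc (j * n + l) \<in> {1..J * n}" using that(2) by auto
    qed (use that n1 in auto)
    have decode: "q = q'" if "?j q = ?j q'" "?l q = ?l q'" "q \<in> {1..J * n}" "q' \<in> {1..J * n}" for q q'
    proof -
      have "q - 1 = q' - 1" using that(1,2) by (metis mult_div_mod_eq)
      then show ?thesis using that(3,4) by auto
    qed
    show "\<exists>(J' :: nat \<Rightarrow> nat) (V :: nat \<Rightarrow> nat \<Rightarrow> 'x set) (s :: nat \<Rightarrow> nat \<Rightarrow> 'g) (k :: nat \<Rightarrow> nat \<Rightarrow> nat).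
          (\<forall>i\<in>{1..n + 1}.
             F i \<subseteq> (\<Union>j\<in>{1..J' i}. V i j) \<and>
             (\<forall>j\<in>{1..J' i}.
                openin X (V i j) \<and> s i j \<in> carrier G \<and> k i j \<in> {1..n} \<and>
                (\<phi> (s i j) ` V i j) \<times> {k i j} \<subseteq> (\<Union>l\<in>{1..n}. B \<times> {l}))) \<and>
          disjoint_family_on (\<lambda>(i, j). (\<phi> (s i j) ` V i j) \<times> {k i j})
            (SIGMA i:{1..n + 1}. {1..J' i})"
    proof (intro exI conjI ballI)
      fix c assume c: "c \<in> {1..n + 1}"
      show "F c \<subseteq> (\<Union>q\<in>{1..J * n}. U c (?j q) (?l q))"
      proof
        fix x assume "x \<in> F c"
        then have "x \<in> O'" using F c by blast
        then obtain j l where "j < J" "l < n" "x \<in> U c j l" using cover c by blast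
        then show "x \<in> (\<Union>q\<in>{1..J * n}. U c (?j q) (?l q))" using code by blast
      qed
      fix q assume q: "q \<in> {1..J * n}"
      show "openin X (U c (?j q) (?l q))" using Uopen jl[OF q] by blast
      show "e (?j q) \<in> carrier G" using eG jl[OF q] by blast
      show "Suc (?l q) \<in> {1..n}" using jl[OF q] by simp
      show "(\<phi> (e (?j q)) ` U c (?j q) (?l q)) \<times> {Suc (?l q)} \<subseteq> (\<Union>l\<in>{1..n}. B \<times> {l})"
        using jl[OF q] UB[of c "?j q"] by (auto simp: U_def)
    next
      show "disjoint_family_on (\<lambda>(c, q). (\<phi> (e (?j q)) ` U c (?j q) (?l q)) \<times> {Suc (?l q)})
            (SIGMA i:{1..n + 1}. {1..J * n})"
        unfolding disjoint_family_on_def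
      proof (intro ballI impI)
        fix p p' assume p: "p \<in> (SIGMA i:{1..n + 1}. {1..J * n})" "p' \<in> (SIGMA i:{1..n + 1}. {1..J * n})" "p \<noteq> p'"
        obtain c q c' q' where pq: "p = (c, q)" "p' = (c', q')" by (metis surj_pair)
        have q: "q \<in> {1..J * n}" "q' \<in> {1..J * n}" using p pq by auto
        have "False" if "x \<in> U c (?j q) (?l q)" "x' \<in> U c' (?j q') (?l q')"
          "\<phi> (e (?j q)) x = \<phi> (e (?j q')) x'" "?l q = ?l q'" for x x'
        proof -
          have "c = c' \<and> ?j q = ?j q'"
            using uniq[of x c "?j q" "?l q" x' c' "?j q'"] that jl(1)[OF q(1)] jl(1)[OF q(2)] by simp
          then show False using decode[of q q'] that(4) q p(3) pq by simp
        qed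
        then show "(case p of (c, q) \<Rightarrow> (\<phi> (e (?j q)) ` U c (?j q) (?l q)) \<times> {Suc (?l q)}) \<inter>
          (case p' of (c, q) \<Rightarrow> (\<phi> (e (?j q)) ` U c (?j q) (?l q)) \<times> {Suc (?l q)}) = {}"
          unfolding pq prod.case by blast
      qed
    qed
  qed
  then show ?thesis using n1 by blast
qed

section \<open>An invariant additive functional\<close>

text \<open>
  On this cone the functional to be constructed is finite. It contains the functions with compact
  support in the saturation of \<open>B\<close>.
\<close>

definition dominated :: "'x set \<Rightarrow> ('x \<Rightarrow> real) set" where
  "dominated B = {f. \<exists>t\<ge>0. transports f (\<lambda>y. t * indicator B y)}"

lemma dominatedE:
  assumes "f \<in> dominated B"
  obtains t where "0 \<le> t" "transports f (\<lambda>y. t * indicator B y)"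
  using assms unfolding dominated_def by blast

lemma dominatedI: "\<lbrakk>0 \<le> t; transports f (\<lambda>y. t * indicator B y)\<rbrakk> \<Longrightarrow> f \<in> dominated B"
  unfolding dominated_def by blast

lemma dominated_nonneg_continuous: "f \<in> dominated B \<Longrightarrow> f \<in> nonneg_continuous X"
  by (elim dominatedE) (rule transports_nonneg_continuous)

lemma dominated_zero: "(\<lambda>_. 0) \<in> dominated B"
proof (rule dominatedI[of 0])
  show "transports (\<lambda>_. 0) (\<lambda>y. 0 * indicator B y)"
    using transports_self[OF nonneg_continuous_const[of 0]] by simp
qed simp

lemma dominated_add:
  assumes "f \<in> dominated B" "g \<in> dominated B"
  shows "(\<lambda>x. f x + g x) \<in> dominated B"
proof -
  obtain s t where s: "0 \<le> s" "transports f (\<lambda>y. s * indicator B y)"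
    and t: "0 \<le> t" "transports g (\<lambda>y. t * indicator B y)"
    using assms by (auto elim!: dominatedE)
  have "transports (\<lambda>x. f x + g x) (\<lambda>y. (s + t) * indicator B y)"
    by (rule transports_cong[OF transports_add[OF s(2) t(2)]]) (simp_all add: algebra_simps)
  then show ?thesis using s t by (intro dominatedI[of "s + t"]) auto
qed

lemma dominated_cmult:
  assumes "0 \<le> c" "f \<in> dominated B"
  shows "(\<lambda>x. c * f x) \<in> dominated B"
proof -
  obtain t where t: "0 \<le> t" "transports f (\<lambda>y. t * indicator B y)"
    using assms(2) by (rule dominatedE)
  have "transports (\<lambda>x. c * f x) (\<lambda>y. (c * t) * indicator B y)"
    by (rule transports_cong[OF transports_cmult[OF assms(1) t(2)]]) (simp_all add: algebra_simps)
  then show ?thesis using assms(1) t by (intro dominatedI[of "c * t"]) auto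
qed

lemma dominated_le:
  assumes "f \<in> nonneg_continuous X" "\<And>x. x \<in> topspace X \<Longrightarrow> f x \<le> g x" "g \<in> dominated B"
  shows "f \<in> dominated B"
  using assms(3) by (rule dominatedE) (blast intro: dominatedI transports_le[OF assms(1,2)])

lemma dominated_translate:
  assumes "a \<in> carrier G" "f \<in> dominated B"
  shows "translate a f \<in> dominated B"
  using assms(2) by (rule dominatedE) (blast intro: dominatedI transports_translate[OF assms(1)])

lemma translate_inv:
  assumes "a \<in> carrier G" "x \<in> topspace X"
  shows "translate (inv\<^bsub>G\<^esub> a) (translate a f) x = f x"
proof -
  have "inv\<^bsub>G\<^esub> (inv\<^bsub>G\<^esub> a) = a" using group assms(1) by (simp add: group.inv_inv)
  then show ?thesis using act_inv(1)[OF assms] by (simp add: translate_def)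
qed

text \<open>
  Translates are related in both directions, so that a monotone functional is invariant.
\<close>

definition equidecomposition_order :: "'x set \<Rightarrow> (('x \<Rightarrow> real) \<times> ('x \<Rightarrow> real)) set" where
  "equidecomposition_order B =
     {(f, g). f \<in> dominated B \<and> g \<in> dominated B \<and>
        ((\<forall>x\<in>topspace X. f x \<le> g x) \<or> (\<exists>a\<in>carrier G. f = translate a g \<or> g = translate a f))}"

text \<open>
  For a pair of translates, split off the summand \<open>g\<close>, move it, and put it back.
\<close>

lemma transports_order:
  assumes k: "k \<in> nonneg_continuous X" and fg: "(f, g) \<in> equidecomposition_order B"
    and tr: "transports (\<lambda>x. k x + g x) w"
  shows "transports (\<lambda>x. k x + f x) w"
proof -
  have nc: "f \<in> nonneg_continuous X" "g \<in> nonneg_continuous X"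
    using fg dominated_nonneg_continuous unfolding equidecomposition_order_def by auto
  have moved: "transports (\<lambda>x. k x + f x) w"
    if "a \<in> carrier G" "\<And>x. x \<in> topspace X \<Longrightarrow> f x = translate a g x" for a
  proof -
    obtain u v where uv: "transports k u" "transports g v" "\<And>y. y \<in> topspace X \<Longrightarrow> u y + v y \<le> w y"
      using transports_split[OF k nc(2) tr] by blast
    show ?thesis
      by (rule transports_cong[OF transports_add[OF uv(1) transports_translate[OF that(1) uv(2)]]])
        (simp_all add: that(2) uv(3))
  qed
  consider "\<forall>x\<in>topspace X. f x \<le> g x" | a where "a \<in> carrier G" "f = translate a g"
    | a where "a \<in> carrier G" "g = translate a f"
    using fg unfolding equidecomposition_order_def by blast
  then show ?thesis
  proof cases
    case 1
    show ?thesis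
      by (rule transports_le[OF nonneg_continuous_add[OF k nc(1)] _ tr]) (use 1 in simp)
  next
    case 2
    then show ?thesis using moved by blast
  next
    case 3
    then show ?thesis using moved[OF inv_closed[OF 3(1)]] translate_inv[OF 3(1)] by simp
  qed
qed

text \<open>
  The gauge is the infimum of \<open>t - r\<close> over the pairs \<open>(t, r)\<close> for which \<open>g + r f0\<close> is transported
  below \<open>t\<close> times the indicator of \<open>B\<close>. By rescaling, the hypothesis on \<open>f0\<close> yields \<open>r \<le> t\<close> for all such
  pairs, so the gauge is nonnegative. The parameter \<open>r\<close> is there to make the addition of \<open>f0\<close> raise
  the gauge by at least \<open>1\<close>: a pair \<open>(t, r)\<close> for \<open>g + f0\<close> is a pair \<open>(t, r + 1)\<close> for \<open>g\<close>.
\<close>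

lemma invariant_additive_functional:
  assumes f0: "f0 \<in> dominated B"
    and no: "\<And>t. \<lbrakk>0 \<le> t; t < 1\<rbrakk> \<Longrightarrow> \<not> transports f0 (\<lambda>y. t * indicator B y)"
  obtains m :: "('x \<Rightarrow> real) \<Rightarrow> real"
    where "\<forall>f\<in>dominated B. \<forall>g\<in>dominated B. m (\<lambda>x. f x + g x) = m f + m g"
      and "\<forall>f g. (f, g) \<in> equidecomposition_order B \<longrightarrow> m f \<le> m g"
      and "\<forall>f. 0 \<le> m f" and "1 \<le> m f0"
      and "\<forall>f. transports f (indicator B) \<longrightarrow> m f \<le> 1"
proof -
  define valid where "valid = (\<lambda>g t r. 0 \<le> t \<and> 0 \<le> r \<and> transports (\<lambda>x. g x + r * f0 x) (\<lambda>y. t * indicator B y))"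
  define p where "p = (\<lambda>g. if g \<in> dominated B then Inf {t - r |t r. valid g t r} else 0)"
  have f0nc: "f0 \<in> nonneg_continuous X" using f0 by (rule dominated_nonneg_continuous)
  have le: "r \<le> t" if v: "valid g t r" and g: "g \<in> nonneg_continuous X" for g t r
  proof (rule ccontr)
    assume "\<not> r \<le> t"
    then have r: "0 < r" "t < r" and t: "0 \<le> t" using v by (auto simp: valid_def)
    have "transports (\<lambda>x. r * f0 x) (\<lambda>y. t * indicator B y)"
    proof (rule transports_le)
      show "(\<lambda>x. r * f0 x) \<in> nonneg_continuous X" using r f0nc by (intro nonneg_continuous_cmult) auto
      show "transports (\<lambda>x. g x + r * f0 x) (\<lambda>y. t * indicator B y)" using v by (simp add: valid_def)
    qed (use nonneg_continuousD(2)[OF g] in simp)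
    then have "transports (\<lambda>x. 1 / r * (r * f0 x)) (\<lambda>y. 1 / r * (t * indicator B y))"
      using r by (intro transports_cmult) auto
    then have "transports f0 (\<lambda>y. (t / r) * indicator B y)" using r by (simp add: mult.assoc)
    moreover have "0 \<le> t / r" "t / r < 1" using r t by auto
    ultimately show False using no by blast
  qed
  have lower: "p g \<le> t - r" if "valid g t r" "g \<in> dominated B" for g t r
  proof -
    have "bdd_below {t - r |t r. valid g t r}"
      using le[OF _ dominated_nonneg_continuous[OF that(2)]] by (intro bdd_belowI[of _ 0]) auto
    then show ?thesis unfolding p_def using that by (auto intro!: cInf_lower)
  qed
  have greatest: "c \<le> p g" if g: "g \<in> dominated B" and c: "\<And>t r. valid g t r \<Longrightarrow> c \<le> t - r" for g c
  proof -
    obtain t where "0 \<le> t" "transports g (\<lambda>y. t * indicator B y)" using g by (rule dominatedE)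
    then have "valid g t 0" by (simp add: valid_def)
    then show ?thesis unfolding p_def using g c by (auto intro!: cInf_greatest)
  qed
  have p0: "p (\<lambda>_. 0) = 0"
  proof (rule antisym)
    have "valid (\<lambda>_. 0) 0 0"
      using transports_self[OF nonneg_continuous_const[of 0]] by (simp add: valid_def)
    then show "p (\<lambda>_. 0) \<le> 0" using lower[OF _ dominated_zero] by force
    show "0 \<le> p (\<lambda>_. 0)"
      using le[OF _ dominated_nonneg_continuous[OF dominated_zero]] by (intro greatest[OF dominated_zero]) auto
  qed
  have scale: "p (\<lambda>x. c * f x) \<le> c * p f" if c: "0 < c" and f: "f \<in> dominated B" for c f
  proof -
    have "p (\<lambda>x. c * f x) / c \<le> t - r" if v: "valid f t r" for t r
    proof -
      have "transports (\<lambda>x. c * (f x + r * f0 x)) (\<lambda>y. c * (t * indicator B y))"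
        using v c by (intro transports_cmult) (auto simp: valid_def)
      then have "valid (\<lambda>x. c * f x) (c * t) (c * r)"
        using v c by (auto simp: valid_def algebra_simps)
      then have "p (\<lambda>x. c * f x) \<le> c * t - c * r" using c f by (intro lower dominated_cmult) auto
      then have "p (\<lambda>x. c * f x) \<le> (t - r) * c" by (simp add: algebra_simps)
      then show ?thesis using c by (simp add: pos_divide_le_eq)
    qed
    then have "p (\<lambda>x. c * f x) / c \<le> p f" by (rule greatest[OF f])
    then show ?thesis using c by (simp add: divide_le_eq mult.commute)
  qed
  interpret functional_cone "dominated B" "equidecomposition_order B" f0 p
  proof
    show "((\<lambda>_. 0), g) \<in> equidecomposition_order B" if "g \<in> dominated B" for g
      using that dominated_zero nonneg_continuousD(2)[OF dominated_nonneg_continuous[OF that]]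
      by (auto simp: equidecomposition_order_def)
  qed (auto simp: dominated_zero dominated_add dominated_cmult f0 equidecomposition_order_def)
  have "admissible p"
  proof (rule admissibleI)
    show "p (\<lambda>x. f x + g x) \<le> p f + p g" if f: "f \<in> dominated B" and g: "g \<in> dominated B" for f g
    proof -
      have "p (\<lambda>x. f x + g x) - p g \<le> t - r" if v: "valid f t r" for t r
      proof -
        have "p (\<lambda>x. f x + g x) - (t - r) \<le> t' - r'" if v': "valid g t' r'" for t' r'
        proof -
          have "transports (\<lambda>x. (f x + r * f0 x) + (g x + r' * f0 x)) (\<lambda>y. t * indicator B y + t' * indicator B y)"
            using v v' by (intro transports_add) (auto simp: valid_def)
          then have "valid (\<lambda>x. f x + g x) (t + t') (r + r')"
            using v v' by (auto simp: valid_def algebra_simps)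
          then have "p (\<lambda>x. f x + g x) \<le> (t + t') - (r + r')" by (intro lower dominated_add f g)
          then show ?thesis by simp
        qed
        then have "p (\<lambda>x. f x + g x) - (t - r) \<le> p g" by (rule greatest[OF g])
        then show ?thesis by linarith
      qed
      then have "p (\<lambda>x. f x + g x) - p g \<le> p f" by (rule greatest[OF f])
      then show ?thesis by linarith
    qed
    show "p (\<lambda>x. c * f x) = c * p f" if c: "0 \<le> c" and f: "f \<in> dominated B" for c f
    proof (cases "c = 0")
      case False
      then have c0: "0 < c" using c by simp
      have "p (\<lambda>x. 1 / c * (c * f x)) \<le> 1 / c * p (\<lambda>x. c * f x)"
        using c0 f by (intro scale dominated_cmult) auto
      then have "c * p f \<le> p (\<lambda>x. c * f x)" using c0 by (simp add: field_simps)
      then show ?thesis using scale[OF c0 f] by simp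
    qed (simp add: p0)
    show "p (\<lambda>x. f x + g x) \<le> p (\<lambda>x. f x + h x)"
      if f: "f \<in> dominated B" and gh: "(g, h) \<in> equidecomposition_order B" for f g h
    proof (rule greatest)
      have gD: "g \<in> dominated B" and hD: "h \<in> dominated B"
        using gh by (auto simp: equidecomposition_order_def)
      show "(\<lambda>x. f x + h x) \<in> dominated B" by (rule dominated_add[OF f hD])
      fix t r assume v: "valid (\<lambda>x. f x + h x) t r"
      have "transports (\<lambda>x. (f x + r * f0 x) + h x) (\<lambda>y. t * indicator B y)"
        using v by (simp add: valid_def algebra_simps)
      then have "transports (\<lambda>x. (f x + r * f0 x) + g x) (\<lambda>y. t * indicator B y)"
        using v by (intro transports_order[OF _ gh] nonneg_continuous_add dominated_nonneg_continuous[OF f]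
            nonneg_continuous_cmult f0nc) (auto simp: valid_def)
      then have "valid (\<lambda>x. f x + g x) t r" using v by (simp add: valid_def algebra_simps)
      then show "p (\<lambda>x. f x + g x) \<le> t - r" by (rule lower[OF _ dominated_add[OF f gD]])
    qed
    show "p f + 1 \<le> p (\<lambda>x. f x + f0 x)" if f: "f \<in> dominated B" for f
    proof (rule greatest[OF dominated_add[OF f f0]])
      fix t r assume "valid (\<lambda>x. f x + f0 x) t r"
      then have "valid f t (1 + r)" by (auto simp: valid_def algebra_simps)
      then have "p f \<le> t - (1 + r)" by (rule lower[OF _ f])
      then show "p f + 1 \<le> t - r" by simp
    qed
  qed (simp_all add: p_def)
  then obtain m where m: "admissible m"
    and add: "\<And>f g. \<lbrakk>f \<in> dominated B; g \<in> dominated B\<rbrakk> \<Longrightarrow> m (\<lambda>x. f x + g x) = m f + m g"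
    using additive_minorant by blast
  have "m f \<le> m g" if "(f, g) \<in> equidecomposition_order B" for f g
    using admissibleD(5)[OF m dominated_zero that] by simp
  moreover have "1 \<le> m f0" using admissibleD(6)[OF m dominated_zero] admissible_zero[OF m] by simp
  moreover have "m f \<le> 1" if "transports f (indicator B)" for f
  proof -
    have "f \<in> dominated B" using that by (intro dominatedI[of 1]) auto
    moreover from that have "valid f 1 0" by (simp add: valid_def)
    ultimately show ?thesis using lower admissibleD(2)[OF m] by fastforce
  qed
  ultimately show ?thesis using add admissible_nonneg[OF m] by (intro that[of m]) auto
qed

section \<open>An invariant premeasure\<close>

lemma image_act_inv:
  assumes "a \<in> carrier G" "E \<subseteq> topspace X"
  shows "\<phi> (inv\<^bsub>G\<^esub> a) ` \<phi> a ` E = E" "\<phi> a ` \<phi> (inv\<^bsub>G\<^esub> a) ` E = E"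
  using assms act_inv by (force simp: image_iff)+

lemma subordinate_translate:
  assumes a: "a \<in> carrier G" and f: "f \<in> subordinate X U"
  shows "translate a f \<in> subordinate X (\<phi> a ` U)"
proof -
  obtain K where K: "closedin X K" "K \<subseteq> U" "\<And>x. x \<in> topspace X - K \<Longrightarrow> f x = 0"
    and f1: "\<And>x. x \<in> topspace X \<Longrightarrow> f x \<le> 1" and fc: "f \<in> nonneg_continuous X"
    using f unfolding subordinate_def by auto
  have KX: "K \<subseteq> topspace X" using K(1) closedin_subset by blast
  have "translate a f x \<le> 1" if "x \<in> topspace X" for x
    unfolding translate_def by (rule f1[OF act_closed[OF inv_closed[OF a] that]])
  moreover have "translate a f x = 0" if "x \<in> topspace X - \<phi> a ` K" for x
    unfolding translate_def
    using that act_closed[OF inv_closed[OF a]] by (intro K(3)) (auto simp: image_act_eq[OF a KX])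
  moreover have "closedin X (\<phi> a ` K)" "\<phi> a ` K \<subseteq> \<phi> a ` U"
    using closed_image_act[OF a K(1)] K(2) by auto
  ultimately show ?thesis
    unfolding subordinate_def using translate_nonneg_continuous[OF a fc] by blast
qed

lemma outer_content_invariant:
  assumes L: "\<And>a f. \<lbrakk>a \<in> carrier G; f \<in> nonneg_continuous X\<rbrakk> \<Longrightarrow> L (translate a f) = L f"
    and a: "a \<in> carrier G" and E: "E \<subseteq> topspace X"
  shows "outer_content X L (\<phi> a ` E) = outer_content X L E"
proof -
  have inner: "inner_content X L U \<le> inner_content X L (\<phi> a ` U)" if a: "a \<in> carrier G" for a U
    unfolding inner_content_def
  proof (rule SUP_least)
    fix f assume f: "f \<in> subordinate X U"
    then have "L f = L (translate a f)" using L[OF a] by (simp add: subordinate_def)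
    also have "\<dots> \<le> (SUP f\<in>subordinate X (\<phi> a ` U). L f)"
      by (rule SUP_upper[OF subordinate_translate[OF a f]])
    finally show "L f \<le> (SUP f\<in>subordinate X (\<phi> a ` U). L f)" .
  qed
  have outer: "outer_content X L (\<phi> a ` E) \<le> outer_content X L E" if a: "a \<in> carrier G" for a E
    unfolding outer_content_def[of X L E]
  proof (rule INF_greatest, clarify)
    fix V assume V: "openin X V" "E \<subseteq> V"
    have "outer_content X L (\<phi> a ` E) \<le> inner_content X L (\<phi> a ` V)"
      unfolding outer_content_def using V open_image_act[OF a V(1)] by (intro INF_lower) auto
    also have "\<dots> \<le> inner_content X L (\<phi> (inv\<^bsub>G\<^esub> a) ` \<phi> a ` V)"
      by (rule inner[OF inv_closed[OF a]])
    also have "\<dots> = inner_content X L V" using image_act_inv(1)[OF a openin_subset[OF V(1)]] by simp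
    finally show "outer_content X L (\<phi> a ` E) \<le> inner_content X L V" .
  qed
  show ?thesis
    using outer[OF a, of E] outer[OF inv_closed[OF a], of "\<phi> a ` E"] image_act_inv(1)[OF a E] by simp
qed

lemma outer_content_invariant_premeasure:
  assumes "additive_functional X L"
    and L: "\<And>a f. \<lbrakk>a \<in> carrier G; f \<in> nonneg_continuous X\<rbrakk> \<Longrightarrow> L (translate a f) = L f"
  shows "outer_content X L \<in> invariant_premeasures G X \<phi>"
proof -
  interpret additive_functional X L by fact
  interpret A: algebra "topspace X" "open_algebra X" by (rule open_algebra_is_algebra)
  show ?thesis
    unfolding invariant_premeasures_def
    using premeasure_outer_content regular_outer_content outer_content_invariant[OF L] A.sets_into_space
    by blast
qed

text \<open>
  A sum of nonnegative continuous functions is dominated only if both summands are, which is why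
  additivity survives the extension by \<open>\<infinity>\<close>.
\<close>

definition extended :: "'x set \<Rightarrow> (('x \<Rightarrow> real) \<Rightarrow> real) \<Rightarrow> ('x \<Rightarrow> real) \<Rightarrow> ennreal" where
  "extended B m f = (if f \<in> dominated B then ennreal (m f) else \<infinity>)"

lemma additive_functional_extended:
  assumes add: "\<And>f g. \<lbrakk>f \<in> dominated B; g \<in> dominated B\<rbrakk> \<Longrightarrow> m (\<lambda>x. f x + g x) = m f + m g"
    and order: "\<And>f g. (f, g) \<in> equidecomposition_order B \<Longrightarrow> m f \<le> m g"
    and nonneg: "\<And>f. 0 \<le> m f"
    and k: "0 < k" "k < \<infinity>"
  shows "additive_functional X (\<lambda>f. k * extended B m f)"
proof
  show "compact_space X" "metrizable_space X" by (rule compact metrizable)+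
  have dom: "f \<in> dominated B \<and> g \<in> dominated B"
    if "f \<in> nonneg_continuous X" "g \<in> nonneg_continuous X" "(\<lambda>x. f x + g x) \<in> dominated B" for f g
    using dominated_le[OF that(1) _ that(3)] dominated_le[OF that(2) _ that(3)]
      nonneg_continuousD(2)[OF that(1)] nonneg_continuousD(2)[OF that(2)] by auto
  show "k * extended B m (\<lambda>x. f x + g x) = k * extended B m f + k * extended B m g"
    if f: "f \<in> nonneg_continuous X" and g: "g \<in> nonneg_continuous X" for f g
  proof -
    have "extended B m (\<lambda>x. f x + g x) = extended B m f + extended B m g"
      using dom[OF f g] dominated_add[of f B g]
      by (auto simp: extended_def add nonneg)
    then show ?thesis by (simp add: distrib_left)
  qed
  show "k * extended B m f \<le> k * extended B m g"
    if f: "f \<in> nonneg_continuous X" and "g \<in> nonneg_continuous X" and le: "\<And>x. x \<in> topspace X \<Longrightarrow> f x \<le> g x" for f g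
  proof (cases "g \<in> dominated B")
    case True
    have "f \<in> dominated B" using dominated_le[OF f le True] by blast
    then show ?thesis
      using True le by (intro mult_left_mono) (auto simp: extended_def equidecomposition_order_def intro!: ennreal_leI order)
  qed (use k in \<open>simp add: extended_def ennreal_mult_top\<close>)
  have "m (\<lambda>_. 0) = 0" using add[OF dominated_zero dominated_zero] by simp
  then show "k * extended B m (\<lambda>_. 0) = 0" by (simp add: extended_def dominated_zero)
qed

lemma extended_translate:
  assumes order: "\<And>f g. (f, g) \<in> equidecomposition_order B \<Longrightarrow> m f \<le> m g"
    and a: "a \<in> carrier G" and f: "f \<in> nonneg_continuous X"
  shows "extended B m (translate a f) = extended B m f"
proof (cases "f \<in> dominated B")
  case True
  have "(f, translate a f) \<in> equidecomposition_order B" "(translate a f, f) \<in> equidecomposition_order B"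
    using True dominated_translate[OF a True] a by (auto simp: equidecomposition_order_def)
  then have "m (translate a f) = m f" using order by (intro antisym)
  then show ?thesis using True dominated_translate[OF a True] by (simp add: extended_def)
next
  case False
  have "translate a f \<notin> dominated B"
  proof
    assume "translate a f \<in> dominated B"
    then have "translate (inv\<^bsub>G\<^esub> a) (translate a f) \<in> dominated B"
      by (rule dominated_translate[OF inv_closed[OF a]])
    then have "f \<in> dominated B"
      using translate_inv[OF a] by (intro dominated_le[OF f]) auto
    then show False using False by simp
  qed
  then show ?thesis using False by (simp add: extended_def)
qed

text \<open>
  The premeasure obtained from the functional gives \<open>B\<close> a value \<open>c \<le> 1\<close>, and \<open>c = 0\<close> would make \<open>A\<close> a
  null set, as countably many translates of \<open>B\<close> cover it. The factor \<open>1 / c \<ge> 1\<close> normalises the value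
  at \<open>B\<close> without lowering the value at \<open>A\<close>.
\<close>

lemma exists_invariant_premeasure:
  assumes countable: "countable (carrier G)"
    and B: "openin X B" and A: "openin X A" and AB: "A \<subseteq> saturation G \<phi> B"
    and f0: "f0 \<in> subordinate X A"
    and no: "\<And>t. \<lbrakk>0 \<le> t; t < 1\<rbrakk> \<Longrightarrow> \<not> transports f0 (\<lambda>y. t * indicator B y)"
  obtains \<mu> where "\<mu> \<in> invariant_premeasures G X \<phi>" "\<mu> B = 1" "1 \<le> \<mu> A"
proof -
  obtain K where K: "closedin X K" "K \<subseteq> A" "\<And>x. x \<in> topspace X - K \<Longrightarrow> f0 x = 0"
    and f0nc: "f0 \<in> nonneg_continuous X"
    using f0 unfolding subordinate_def by auto
  have f0D: "f0 \<in> dominated B"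
    using compact_support_transports[OF B f0nc K(1) _ K(3)] K(2) AB by (auto simp: dominated_def)
  obtain m :: "('x \<Rightarrow> real) \<Rightarrow> real"
    where m: "\<forall>f\<in>dominated B. \<forall>g\<in>dominated B. m (\<lambda>x. f x + g x) = m f + m g"
      "\<forall>f g. (f, g) \<in> equidecomposition_order B \<longrightarrow> m f \<le> m g"
      "\<forall>f. 0 \<le> m f" "1 \<le> m f0" "\<forall>f. transports f (indicator B) \<longrightarrow> m f \<le> 1"
    by (rule invariant_additive_functional[OF f0D no])
  note add = m(1)[rule_format] and order = m(2)[rule_format] and nonneg = m(3)[rule_format]
    and mf0 = m(4) and mB = m(5)[rule_format]
  define L where "L = extended B m"
  have L: "additive_functional X (\<lambda>f. k * L f)" if "0 < k" "k < \<infinity>" for k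
    unfolding L_def by (rule additive_functional_extended[OF add order nonneg that])
  have L1: "additive_functional X L" using L[of 1] by simp
  have Linv: "L (translate a f) = L f" if "a \<in> carrier G" "f \<in> nonneg_continuous X" for a f
    unfolding L_def by (rule extended_translate[OF order that])
  interpret L: additive_functional X L by (rule L1)
  have Lf0: "1 \<le> L f0" using mf0 f0D by (simp add: L_def extended_def)
  define c where "c = inner_content X L B"
  have c1: "c \<le> 1"
    unfolding c_def inner_content_def
  proof (rule SUP_least)
    fix f assume f: "f \<in> subordinate X B"
    have "transports f (indicator B)"
    proof (rule transports_cong[OF transports_self])
      show "f \<in> nonneg_continuous X" using f by (simp add: subordinate_def)
      obtain K where "K \<subseteq> B" "\<forall>x\<in>topspace X - K. f x = 0" "\<forall>x\<in>topspace X. f x \<le> 1"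
        using f unfolding subordinate_def by blast
      then show "f y \<le> indicator B y" if "y \<in> topspace X" for y
        using that by (cases "y \<in> B") force+
    qed simp
    then have "m f \<le> 1" "f \<in> dominated B" using mB by (auto intro: dominatedI[of 1])
    then show "L f \<le> 1" by (simp add: L_def extended_def)
  qed
  have innerA: "1 \<le> inner_content X L A"
    unfolding inner_content_def using Lf0 SUP_upper[OF f0, of L] by (rule order_trans)
  have c0: "c \<noteq> 0"
  proof
    assume "c = 0"
    then have B0: "outer_content X L B = 0" using L.outer_content_open[OF B] by (simp add: c_def)
    let ?g = "from_nat_into (carrier G)"
    have ne: "carrier G \<noteq> {}" using one_closed by blast
    have g: "?g n \<in> carrier G" for n using ne by (rule from_nat_into)
    have "A \<subseteq> (\<Union>n. \<phi> (?g n) ` B)"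
    proof
      fix x assume "x \<in> A"
      then obtain a where "a \<in> carrier G" "x \<in> \<phi> a ` B" using AB unfolding saturation_def by blast
      then show "x \<in> (\<Union>n. \<phi> (?g n) ` B)" using from_nat_into_surj[OF countable] by blast
    qed
    then have "outer_content X L A \<le> outer_content X L (\<Union>n. \<phi> (?g n) ` B)"
      by (rule L.outer_content_mono)
    also have "\<dots> \<le> (\<Sum>n. outer_content X L (\<phi> (?g n) ` B))"
      by (rule L.outer_content_countably_subadditive)
    also have "\<dots> = 0"
      using outer_content_invariant[OF Linv g openin_subset[OF B]] B0 by simp
    finally show False using innerA L.outer_content_open[OF A] by simp
  qed
  obtain r where r: "c = ennreal r" "0 < r" "r \<le> 1"
    using c0 c1 by (cases c) (auto simp: top_unique)
  define k where "k = ennreal (1 / r)"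
  have k: "0 < k" "k < \<infinity>" "k * c = 1" "1 \<le> k"
    unfolding k_def r(1) using r(2,3) by (simp_all flip: ennreal_mult ennreal_1)
  let ?L = "\<lambda>f. k * L f"
  interpret kL: additive_functional X ?L by (rule L[OF k(1,2)])
  have inner: "inner_content X ?L U = k * inner_content X L U" for U
    unfolding inner_content_def using subordinate_zero by (subst SUP_mult_left_ennreal) auto
  show ?thesis
  proof
    show "outer_content X ?L \<in> invariant_premeasures G X \<phi>"
      by (rule outer_content_invariant_premeasure[OF L[OF k(1,2)]]) (simp add: Linv)
    show "outer_content X ?L B = 1"
      using k(3) by (simp add: kL.outer_content_open[OF B] inner c_def)
    have "1 * 1 \<le> k * inner_content X L A" by (intro mult_mono k innerA) auto
    then show "1 \<le> outer_content X ?L A"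
      by (simp add: kL.outer_content_open[OF A] inner)
  qed
qed

section \<open>Comparison\<close>

text \<open>
  The special case in which the same closed set is chosen in every copy of \<open>A\<close>.
\<close>

lemma dyn_subeq_multE:
  assumes sub: "dyn_subeq_mult G X \<phi> n A m B" and F: "closedin X F" "F \<subseteq> A"
  obtains U :: "nat \<Rightarrow> nat \<Rightarrow> 'x set" and J :: "nat \<Rightarrow> nat" and s :: "nat \<Rightarrow> nat \<Rightarrow> 'g" and k :: "nat \<Rightarrow> nat \<Rightarrow> nat"
  where "\<forall>i\<in>{1..n}. F \<subseteq> (\<Union>j\<in>{1..J i}. U i j)"
    and "\<forall>i\<in>{1..n}. \<forall>j\<in>{1..J i}.
         openin X (U i j) \<and> s i j \<in> carrier G \<and> k i j \<in> {1..m} \<and> \<phi> (s i j) ` U i j \<subseteq> B"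
    and "disjoint_family_on (\<lambda>(i, j). (\<phi> (s i j) ` U i j) \<times> {k i j}) (SIGMA i:{1..n}. {1..J i})"
proof -
  have "\<forall>i\<in>{1..n}. closedin X F \<and> F \<subseteq> A" using F by blast
  from mp[OF spec[OF sub[unfolded dyn_subeq_mult_def dyn_subeq_def], of "\<lambda>_. F"] this]
  show ?thesis
  proof (elim exE conjE)
    fix J :: "nat \<Rightarrow> nat" and U s k
    assume *: "\<forall>i\<in>{1..n}. F \<subseteq> (\<Union>j\<in>{1..J i}. U i j) \<and>
     (\<forall>j\<in>{1..J i}. openin X (U i j) \<and> s i j \<in> carrier G \<and> k i j \<in> {1..m} \<and>
         \<phi> (s i j) ` U i j \<times> {k i j} \<subseteq> (\<Union>l\<in>{1..m}. B \<times> {l}))"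
    assume dis: "disjoint_family_on (\<lambda>(i, j). (\<phi> (s i j) ` U i j) \<times> {k i j}) (SIGMA i:{1..n}. {1..J i})"
    show ?thesis
    proof (rule that[OF _ _ dis])
      show "\<forall>i\<in>{1..n}. F \<subseteq> (\<Union>j\<in>{1..J i}. U i j)" using * by blast
      show "\<forall>i\<in>{1..n}. \<forall>j\<in>{1..J i}.
         openin X (U i j) \<and> s i j \<in> carrier G \<and> k i j \<in> {1..m} \<and> \<phi> (s i j) ` U i j \<subseteq> B"
      proof (intro ballI)
        fix i j assume i: "i \<in> {1..n}" and j: "j \<in> {1..J i}"
        note h = bspec[OF conjunct2[OF bspec[OF * i]] j]
        have "\<phi> (s i j) ` U i j \<subseteq> B"
        proof
          fix y assume "y \<in> \<phi> (s i j) ` U i j"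
          then have "(y, k i j) \<in> (\<Union>l\<in>{1..m}. B \<times> {l})" using h by blast
          then show "y \<in> B" by simp
        qed
        with h show "openin X (U i j) \<and> s i j \<in> carrier G \<and> k i j \<in> {1..m} \<and> \<phi> (s i j) ` U i j \<subseteq> B"
          by (intro conjI) (elim conjE, assumption)+
      qed
    qed
  qed
qed

lemma dyn_subeq_saturation:
  assumes "openin X A" and sub: "dyn_subeq_mult G X \<phi> (n + 1) A n B"
  shows "A \<subseteq> saturation G \<phi> B"
proof
  fix x assume x: "x \<in> A"
  then have xX: "x \<in> topspace X" using assms(1) openin_subset by blast
  have "closedin X {x}" using xX hausdorff by (simp add: closedin_Hausdorff_sing_eq)
  moreover have "{x} \<subseteq> A" using x by simp
  ultimately obtain U J s k where cov: "\<forall>i\<in>{1..n + 1}. {x} \<subseteq> (\<Union>j\<in>{1..J i :: nat}. U i j)"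
    and U: "\<forall>i\<in>{1..n + 1}. \<forall>j\<in>{1..J i}.
         openin X (U i j) \<and> s i j \<in> carrier G \<and> k i j \<in> {1..n} \<and> \<phi> (s i j) ` U i j \<subseteq> B"
    and "disjoint_family_on (\<lambda>(i, j). (\<phi> (s i j) ` U i j) \<times> {k i j}) (SIGMA i:{1..n + 1}. {1..J i})"
    by (rule dyn_subeq_multE[OF sub])
  have 1: "1 \<in> {1..n + 1}" by simp
  obtain j where j: "j \<in> {1..J 1}" "x \<in> U 1 j" using bspec[OF cov 1] by blast
  have "s 1 j \<in> carrier G" "\<phi> (s 1 j) ` U 1 j \<subseteq> B" using bspec[OF bspec[OF U 1] j(1)] by auto
  then have "s 1 j \<in> carrier G" "\<phi> (s 1 j) x \<in> B" using j(2) by auto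
  then show "x \<in> saturation G \<phi> B"
    unfolding saturation_def using act_inv(1)[OF _ xX, of "s 1 j"] inv_closed by force
qed

text \<open>
  For closed \<open>F \<subseteq> A\<close>, the moved pieces covering \<open>n + 1\<close> copies of \<open>F\<close> pack disjointly into \<open>n\<close> copies of
  \<open>B\<close>, so \<open>\<mu> F \<le> n / (n + 1)\<close>. By inner regularity this bound, which does not depend on \<open>F\<close>, passes to \<open>A\<close>.
\<close>

lemma dyn_subeq_imp_premeasure_less:
  assumes A: "openin X A" and B: "openin X B" and sub: "dyn_subeq_mult G X \<phi> (n + 1) A n B"
    and \<mu>: "\<mu> \<in> invariant_premeasures G X \<phi>" "\<mu> B = 1"
  shows "\<mu> A < 1"
proof -
  interpret M: algebra "topspace X" "open_algebra X" by (rule open_algebra_is_algebra)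
  have pos: "positive (open_algebra X) \<mu>" and ca: "countably_additive (open_algebra X) \<mu>"
    and inv: "\<And>g E. \<lbrakk>g \<in> carrier G; E \<in> open_algebra X\<rbrakk> \<Longrightarrow> \<mu> (\<phi> g ` E) = \<mu> E"
    and reg: "regular_on X \<mu>"
    using \<mu>(1) unfolding invariant_premeasures_def premeasure_on_def by blast+
  have ad: "additive (open_algebra X) \<mu>" using M.countably_additive_additive[OF pos ca] .
  have inc: "increasing (open_algebra X) \<mu>" using M.additive_increasing[OF pos ad] .
  have op: "U \<in> open_algebra X" if "openin X U" for U using that by (rule openin_open_algebra)
  have bound: "of_nat (n + 1) * \<mu> F \<le> of_nat n" if F: "closedin X F" "F \<subseteq> A" for F
  proof -
    obtain U J s k where cov: "\<forall>i\<in>{1..n + 1}. F \<subseteq> (\<Union>j\<in>{1..J i :: nat}. U i j)"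
      and U: "\<forall>i\<in>{1..n + 1}. \<forall>j\<in>{1..J i}.
         openin X (U i j) \<and> s i j \<in> carrier G \<and> k i j \<in> {1..n} \<and> \<phi> (s i j) ` U i j \<subseteq> B"
      and dis: "disjoint_family_on (\<lambda>(i, j). (\<phi> (s i j) ` U i j) \<times> {k i j}) (SIGMA i:{1..n + 1}. {1..J i})"
      by (rule dyn_subeq_multE[OF sub F])
    note * = bspec[OF cov] and ** = bspec[OF bspec[OF U]]
    define W where "W = (\<lambda>(i, j). \<phi> (s i j) ` U i j)"
    define S where "S = (SIGMA i:{1..n + 1}. {1..J i})"
    have Fm: "F \<in> open_algebra X"
    proof -
      have "topspace X - (topspace X - F) \<in> open_algebra X"
        using F(1) by (intro M.compl_sets op) auto
      moreover have "topspace X - (topspace X - F) = F" using closedin_subset[OF F(1)] by blast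
      ultimately show ?thesis by simp
    qed
    have finS: "finite S" by (simp add: S_def)
    have WU: "W (i, j) \<in> open_algebra X" "\<mu> (W (i, j)) = \<mu> (U i j)" "W (i, j) \<subseteq> B"
      if "i \<in> {1..n + 1}" "j \<in> {1..J i}" for i j
    proof -
      note h = **[OF that]
      show "W (i, j) \<in> open_algebra X" using h op open_image_act by (simp add: W_def)
      show "\<mu> (W (i, j)) = \<mu> (U i j)" using h inv op by (simp add: W_def)
      show "W (i, j) \<subseteq> B" using h by (auto simp: W_def)
    qed
    have "of_nat (n + 1) * \<mu> F = (\<Sum>i\<in>{1..n + 1}. \<mu> F)" by simp
    also have "\<dots> \<le> (\<Sum>i\<in>{1..n + 1}. \<Sum>j\<in>{1..J i}. \<mu> (W (i, j)))"
    proof (rule sum_mono)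
      fix i assume i: "i \<in> {1..n + 1}"
      have "\<mu> F \<le> \<mu> (\<Union>j\<in>{1..J i}. U i j)"
        using *[OF i] **[OF i] Fm op by (intro increasingD[OF inc]) auto
      also have "\<dots> \<le> (\<Sum>j\<in>{1..J i}. \<mu> (U i j))"
        using **[OF i] op by (intro M.subadditive[OF pos ad]) auto
      also have "\<dots> = (\<Sum>j\<in>{1..J i}. \<mu> (W (i, j)))" using WU(2)[OF i] by simp
      finally show "\<mu> F \<le> (\<Sum>j\<in>{1..J i}. \<mu> (W (i, j)))" .
    qed
    also have "\<dots> = (\<Sum>p\<in>S. \<mu> (W p))"
      unfolding S_def by (subst sum.Sigma) (auto simp: case_prod_unfold)
    also have "\<dots> = (\<Sum>l\<in>{1..n}. \<Sum>p\<in>{p \<in> S. case_prod k p = l}. \<mu> (W p))"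
      by (rule sum.group[symmetric]) (use ** finS in \<open>auto simp: S_def\<close>)
    also have "\<dots> \<le> (\<Sum>l\<in>{1..n}. \<mu> B)"
    proof (rule sum_mono)
      fix l assume "l \<in> {1..n}"
      let ?S = "{p \<in> S. case_prod k p = l}"
      have Wm: "W p \<in> open_algebra X" "W p \<subseteq> B" if p: "p \<in> ?S" for p
      proof -
        obtain i j where "p = (i, j)" "i \<in> {1..n + 1}" "j \<in> {1..J i}" using p by (auto simp: S_def)
        then show "W p \<in> open_algebra X" "W p \<subseteq> B" using WU by blast+
      qed
      have "disjoint_family_on W ?S"
        unfolding disjoint_family_on_def
      proof (intro ballI impI)
        fix p q assume pq: "p \<in> ?S" "q \<in> ?S" "p \<noteq> q"
        then have "(case p of (i, j) \<Rightarrow> (\<phi> (s i j) ` U i j) \<times> {k i j}) \<inter>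
            (case q of (i, j) \<Rightarrow> (\<phi> (s i j) ` U i j) \<times> {k i j}) = {}"
          using disjoint_family_onD[OF dis, of p q] by (auto simp: S_def)
        then show "W p \<inter> W q = {}" using pq by (auto simp: W_def split: prod.splits)
      qed
      then have "(\<Sum>p\<in>?S. \<mu> (W p)) = \<mu> (\<Union>p\<in>?S. W p)"
        using Wm finS by (intro M.additive_sum[OF pos ad]) auto
      also have "\<dots> \<le> \<mu> B"
      proof (rule increasingD[OF inc])
        show "(\<Union>p\<in>?S. W p) \<subseteq> B" using Wm(2) by blast
        show "(\<Union>p\<in>?S. W p) \<in> open_algebra X" using Wm(1) finS by (intro M.finite_UN) auto
      qed (rule op[OF B])
      finally show "(\<Sum>p\<in>?S. \<mu> (W p)) \<le> \<mu> B" .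
    qed
    also have "\<dots> = of_nat n" using \<mu>(2) by simp
    finally show ?thesis .
  qed
  have "\<mu> A = (SUP F\<in>{F. F \<subseteq> A \<and> compactin X F}. \<mu> F)"
    using reg op[OF A] unfolding regular_on_def by blast
  also have "\<dots> \<le> ennreal (real n / real (n + 1))"
  proof (rule SUP_least)
    fix F assume "F \<in> {F. F \<subseteq> A \<and> compactin X F}"
    then have le: "of_nat (n + 1) * \<mu> F \<le> of_nat n"
      using compactin_imp_closedin[OF hausdorff] by (intro bound) auto
    show "\<mu> F \<le> ennreal (real n / real (n + 1))"
    proof (cases "\<mu> F")
      case (real r)
      have "ennreal (real (n + 1) * r) \<le> ennreal (real n)"
        using le real by (simp add: ennreal_mult ennreal_of_nat_eq_real_of_nat)
      then have "real (n + 1) * r \<le> real n" by (subst (asm) ennreal_le_iff) auto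
      then show ?thesis using real by (simp add: ennreal_leI pos_le_divide_eq mult.commute)
    next
      case top
      then show ?thesis using le by (simp add: ennreal_mult_top top_unique del: of_nat_add of_nat_Suc)
    qed
  qed
  also have "\<dots> < 1" using ennreal_lessI[of 1 "real n / real (n + 1)"] by simp
  finally show ?thesis .
qed

text \<open>
  The set \<open>O'\<close> is a superlevel set of a Urysohn function whose truncation to \<open>[0, 1]\<close> is equal to \<open>1\<close>
  there and is supported in \<open>A\<close>.
\<close>

lemma premeasure_less_imp_dyn_subeq:
  assumes countable: "countable (carrier G)"
    and B: "openin X B" and A: "openin X A" and AB: "A \<subseteq> saturation G \<phi> B"
    and \<mu>: "\<And>\<mu>. \<lbrakk>\<mu> \<in> invariant_premeasures G X \<phi>; \<mu> B = 1\<rbrakk> \<Longrightarrow> \<mu> A < 1"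
    and F: "closedin X F" "F \<subseteq> A"
  obtains O' n where "openin X O'" "F \<subseteq> O'" "n \<ge> 1" "dyn_subeq_mult G X \<phi> (n + 1) O' n B"
proof -
  have dis: "disjnt F (topspace X - A)" using F by (auto simp: disjnt_def)
  have cl: "closedin X (topspace X - A)" using A by auto
  obtain q where qc: "continuous_map X euclideanreal q" and q1: "q ` F \<subseteq> {2::real}" and q0: "q ` (topspace X - A) \<subseteq> {-1}"
    by (rule Urysohn_lemma_alt[OF normal F(1) cl dis])
  \<comment> \<open>The values \<open>2\<close> on \<open>F\<close> and \<open>-1\<close> off \<open>A\<close> leave room on both sides: \<open>f\<close> is equal to \<open>1\<close> on an open set
    around \<open>F\<close>, and it vanishes off a closed subset of \<open>A\<close>.\<close>
  define f where "f = (\<lambda>x. min 1 (max 0 (q x)))"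
  have fc: "continuous_map X euclideanreal f" unfolding f_def
    by (intro continuous_map_real_min continuous_map_real_max qc) auto
  have K: "closedin X {x \<in> topspace X. 0 \<le> q x}"
    using qc unfolding continuous_map_upper_lower_semicontinuous_le by blast
  have O: "openin X {x \<in> topspace X. 1 < q x}"
    using qc unfolding continuous_map_upper_lower_semicontinuous_lt by blast
  have "f \<in> subordinate X A"
    unfolding subordinate_def
  proof (intro CollectI conjI exI)
    show "f \<in> nonneg_continuous X" using fc by (rule nonneg_continuousI) (simp add: f_def)
    show "{x \<in> topspace X. 0 \<le> q x} \<subseteq> A" using q0 by force
  qed (use K in \<open>auto simp: f_def\<close>)
  moreover have "\<not> (\<exists>\<mu>\<in>invariant_premeasures G X \<phi>. \<mu> B = 1 \<and> 1 \<le> \<mu> A)"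
    using \<mu> by (meson not_le)
  ultimately obtain t where t: "0 \<le> t" "t < 1" "transports f (\<lambda>y. t * indicator B y)"
    using exists_invariant_premeasure[OF countable B A AB] by metis
  have "1 \<le> f x" if "x \<in> {x \<in> topspace X. 1 < q x}" for x using that by (simp add: f_def)
  then obtain n where "n \<ge> 1" "dyn_subeq_mult G X \<phi> (n + 1) {x \<in> topspace X. 1 < q x} n B"
    using transports_imp_dyn_subeq_mult[OF O openin_subset[OF B] t] by blast
  moreover have "F \<subseteq> {x \<in> topspace X. 1 < q x}" using q1 closedin_subset[OF F(1)] by force
  ultimately show ?thesis using that[OF O] by blast
qed

end

text \<open>
  The relation tests one closed subset of \<open>A\<close> at a time, and only that subset has to be covered.
\<close>

lemma dyn_subeq_mult_locally:
  assumes "\<And>F. closedin X F \<Longrightarrow> F \<subseteq> A \<Longrightarrow> \<exists>O'. F \<subseteq> O' \<and> dyn_subeq_mult G X \<phi> 1 O' 1 B"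
  shows "dyn_subeq_mult G X \<phi> 1 A 1 B"
  unfolding dyn_subeq_mult_def dyn_subeq_def
proof (intro allI impI)
  fix F :: "nat \<Rightarrow> 'a set" assume F: "\<forall>i\<in>{1..1}. closedin X (F i) \<and> F i \<subseteq> A"
  then obtain O' where O': "F 1 \<subseteq> O'" "dyn_subeq G X \<phi> 1 (\<lambda>_. O') 1 (\<lambda>_. B)"
    using assms[of "F 1"] unfolding dyn_subeq_mult_def by auto
  show "\<exists>(J :: nat \<Rightarrow> nat) (U :: nat \<Rightarrow> nat \<Rightarrow> 'a set) s (k :: nat \<Rightarrow> nat \<Rightarrow> nat).
          (\<forall>i\<in>{1..1}.
             F i \<subseteq> (\<Union>j\<in>{1..J i}. U i j) \<and>
             (\<forall>j\<in>{1..J i}.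
                openin X (U i j) \<and> s i j \<in> carrier G \<and> k i j \<in> {1..1} \<and>
                (\<phi> (s i j) ` U i j) \<times> {k i j} \<subseteq> (\<Union>l\<in>{1..1}. B \<times> {l}))) \<and>
          disjoint_family_on (\<lambda>(i, j). (\<phi> (s i j) ` U i j) \<times> {k i j})
            (SIGMA i:{1..1}. {1..J i})"
    by (rule O'(2)[unfolded dyn_subeq_def, rule_format, of F]) (use F O' in auto)
qed

lemma dyn_subeq_mult_empty: "dyn_subeq_mult G X \<phi> n {} m B"
  unfolding dyn_subeq_mult_def dyn_subeq_def
  by (intro allI impI exI[of _ "\<lambda>_. 0"]) (auto simp: disjoint_family_on_def)

theorem theoremB:
  fixes G :: "('g, 'b) monoid_scheme"
    and X :: "'x topology"
    and \<phi> :: "'g \<Rightarrow> 'x \<Rightarrow> 'x"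
  assumes "group G" and "countable (carrier G)" and "infinite (carrier G)"
    and "compact_space X" and "metrizable_space X" and "infinite (topspace X)"
    and "continuous_action G X \<phi>"
  shows "(\<forall>A B. openin X A \<and> A \<noteq> {} \<and> openin X B \<and> B \<noteq> {} \<and>
                (\<exists>n::nat. n \<ge> 1 \<and> dyn_subeq_mult G X \<phi> (n + 1) A n B) \<longrightarrow>
                dyn_subeq_mult G X \<phi> 1 A 1 B)
         \<longleftrightarrow> dynamical_comparison G X \<phi>"
proof -
  interpret compact_metrizable_action G X \<phi>
    using assms by (simp add: compact_metrizable_action_def)
  show ?thesis
  proof
    assume unperforated: "\<forall>A B. openin X A \<and> A \<noteq> {} \<and> openin X B \<and> B \<noteq> {} \<and>
                (\<exists>n::nat. n \<ge> 1 \<and> dyn_subeq_mult G X \<phi> (n + 1) A n B) \<longrightarrow>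
                dyn_subeq_mult G X \<phi> 1 A 1 B"
    show "dynamical_comparison G X \<phi>"
      unfolding dynamical_comparison_def
    proof (intro allI impI, elim conjE)
      fix A B assume A: "openin X A" and B: "openin X B" and AB: "A \<subseteq> saturation G \<phi> B"
        and \<mu>: "\<forall>\<mu>\<in>invariant_premeasures G X \<phi>. \<mu> B = 1 \<longrightarrow> \<mu> A < 1"
      show "dyn_subeq_mult G X \<phi> 1 A 1 B"
      proof (rule dyn_subeq_mult_locally)
        fix F assume F: "closedin X F" "F \<subseteq> A"
        show "\<exists>O'. F \<subseteq> O' \<and> dyn_subeq_mult G X \<phi> 1 O' 1 B"
        proof (cases "F = {}")
          case True
          then show ?thesis using dyn_subeq_mult_empty by blast
        next
          case False
          then have "B \<noteq> {}" using F(2) AB by (auto simp: saturation_def)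
          obtain O' n where O': "openin X O'" "F \<subseteq> O'" "n \<ge> 1" "dyn_subeq_mult G X \<phi> (n + 1) O' n B"
            using premeasure_less_imp_dyn_subeq[OF assms(2) B A AB _ F] \<mu> by blast
          have "O' \<noteq> {}" using False O'(2) by blast
          then have "dyn_subeq_mult G X \<phi> 1 O' 1 B"
            using unperforated O' B \<open>B \<noteq> {}\<close> by blast
          then show ?thesis using O'(2) by blast
        qed
      qed
    qed
  next
    assume comparison: "dynamical_comparison G X \<phi>"
    show "\<forall>A B. openin X A \<and> A \<noteq> {} \<and> openin X B \<and> B \<noteq> {} \<and>
                (\<exists>n::nat. n \<ge> 1 \<and> dyn_subeq_mult G X \<phi> (n + 1) A n B) \<longrightarrow>
                dyn_subeq_mult G X \<phi> 1 A 1 B"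
    proof (intro allI impI, elim conjE exE)
      fix A B n assume A: "openin X A" and B: "openin X B" and sub: "dyn_subeq_mult G X \<phi> (n + 1) A n B"
      have "A \<subseteq> saturation G \<phi> B" by (rule dyn_subeq_saturation[OF A sub])
      moreover have "\<forall>\<mu>\<in>invariant_premeasures G X \<phi>. \<mu> B = 1 \<longrightarrow> \<mu> A < 1"
        using dyn_subeq_imp_premeasure_less[OF A B sub] by blast
      ultimately show "dyn_subeq_mult G X \<phi> 1 A 1 B"
        using comparison A B unfolding dynamical_comparison_def by blast
    qed
  qed
qed

end
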